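(* Let $b$ be a prime, $m\in\mathbb{N}$, $N=b^m$, $s\in\mathbb{N}$, let $\gamma_{\mathfrak{u}}=\prod_{j\in\mathfrak{u}}\gamma_j$ be product weights with positive $\gamma_j$, let $0\le w_1\le w_2\le\cdots$ be integers, and let $s^*$ be the largest integer with $w_{s^*}<m$. Then the computational complexity of the reduced fast successive coordinate search (SCS) algorithm described in the context, started from an initial vector of the form required there, is $$\mathcal{O}\left(m\,b^m+\min\{s,s^*\}\,b^m+\sum_{d=1}^{\min\{s,s^*\}}(m-w_d)\,b^{m-w_d}\right).$$
   Context: Setting: weighted Korobov space of smoothness $\alpha>1$ with product weights. For $\boldsymbol{\xi}=(\xi_1,\ldots,\xi_s)\in\{0,\ldots,N-1\}^s$ the squared worst-case error of the lattice rule with nodes $\{k\boldsymbol{\xi}/N\}$, $0\le k<N$ ($\{\cdot\}$ = componentwise fractional part), is $$e_{N,s}^2(\boldsymbol{\xi})=-1+\frac1N\sum_{k=0}^{N-1}\prod_{j=1}^s\left(1+\gamma_j\,\omega\left(\left\{\tfrac{k\xi_j}{N}\right\}\right)\right),\qquad \omega(x)=\sum_{h\in\mathbb{Z}\setminus\{0\}}\frac{\exp(2\pi\mathrm{i}hx)}{|h|^\alpha},$$ where $\omega$ is real-valued with $\omega(x)=\omega(1-x)$ on $[0,1]$. It is assumed that $\omega$ can be evaluated at $N$ distinct arguments at a cost of at most $\mathcal{O}(N\log N)$. Put $Y_j=b^{w_j}$; $\mathcal{Z}_{N,w_j}=\{z\in\{1,\ldots,b^{m-w_j}-1\}:\gcd(z,N)=1\}$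 if $w_j<m$ and $\mathcal{Z}_{N,w_j}=\{1\}$ if $w_j\ge m$. The initial vector is required to be of the form $\boldsymbol{z}^0=(z_1^0,\ldots,z_s^0)\equiv(Y_1\bar z_1,\ldots,Y_s\bar z_s)\bmod N$ with $\bar z_j\in\mathcal{Z}_{N,w_j}$ for all $j\in\{1,\ldots,s\}$ (so $z_j^0\equiv0 \bmod N$ for $j>s^*$). For $w<m$ let $\Omega_{b^{m-w}}=\left[\omega\left(\frac{kz\bmod b^{m-w}}{b^{m-w}}\right)\right]_{z\in\mathcal{Z}_{N,w},\,k\in\{0,\ldots,b^{m-w}-1\}}$. Reduced fast SCS algorithm: 1. Precomputation: (a) compute and store $\omega(k/b^m)$ for $k=0,\ldots,b^m-1$; (b) initialize $q(k)=\prod_{j=1}^s\left(1+\gamma_j\,\omega\left(\frac{kz_j^0\bmod b^m}{b^m}\right)\right)$ for $k=0,\ldots,b^m-1$; (c) set $d=1$ and set $s^*$ to be the largest integer such that $w_{s^*}<m$. While $d\le\min\{s,s^*\}$: 2. For $k=0,\ldots,b^m-1$, obtain from $q(k)$, by dividing out the factor belonging to $z_d^0$, the value $q_d(k)=\prod_{j=1}^{d-1}\left(1+\gamma_j\omega(\{kY_jz_j/N\})\right)\prod_{j=d+1}^s\left(1+\gamma_j\omega(\{kz_j^0/N\})\right)$. 3. Partition the vector $(q_d(k))_k$ into $b^{w_d}$ consecutive pieces of length $b^{m-w_d}$ and add them up to get $\boldsymbol{q}'_d$, i.e. $q'_d(k)=\sum_{\ell=0}^{b^{w_d}-1}q_d(k+\ell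 b^{m-w_d})$ for $0\le k<b^{m-w_d}$. 4. Compute $(T_d(z))_{z\in\mathcal{Z}_{N,w_d}}=\Omega_{b^{m-w_d}}\boldsymbol{q}'_d$ using fast Fourier transforms (exploiting the fact that, after suitable reordering of rows and columns, the matrix has a structure of repeated circulant blocks). 5. Set $z_d=\arg\min_{z\in\mathcal{Z}_{N,w_d}}T_d(z)$. 6. For $k=0,\ldots,b^m-1$, update $q(k)=q_d(k)\left(1+\gamma_d\,\omega(\{kY_dz_d/N\})\right)$. 7. Increase $d$ by $1$. If $s>s^*$, set $z_{s^*+1}=\cdots=z_s=1$. The resulting generating vector is $(Y_1z_1,\ldots,Y_sz_s)$, and its squared worst-case error is then given as $e_{N,s}^2(Y_1z_1,\ldots,Y_sz_s)=-1+\frac{1}{b^m}\sum_{k=0}^{b^m-1}q(k)$.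
   Formalization: For s > s* the operations on the trailing coordinates (forming the constant product of (1+γ_j ω(0)) over j > s* and setting z_j = 1) are not counted, since they alone take about s − s* operations, which the stated bound, constant in s for s > s*, cannot cover. *)

theory Defs
  imports
    "HOL-Analysis.Analysis"
    "HOL-Library.Landau_Symbols"
    "HOL-Library.Extended_Nat"
    "HOL-Library.Monad_Syntax"
    "HOL-Number_Theory.Residue_Primitive_Roots"
begin

text \<open>The series is real-valued, so taking the real part loses nothing.\<close>

definition omega :: "real \<Rightarrow> real \<Rightarrow> real" where
  "omega \<alpha> x = Re (\<Sum>\<^sub>\<infinity>h\<in>UNIV - {0::int}.
     exp (2 * of_real pi * \<i> * of_int h * of_real x) / of_real (\<bar>of_int h\<bar> powr \<alpha>))"

definition wce_factor :: "real \<Rightarrow> (nat \<Rightarrow> real) \<Rightarrow> nat \<Rightarrow> nat \<Rightarrow> nat \<Rightarrow> nat \<Rightarrow> real" where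
  "wce_factor \<alpha> \<gamma> N j \<xi> k = 1 + \<gamma> j * omega \<alpha> (frac (real k * real \<xi> / real N))"

definition sq_wce :: "real \<Rightarrow> (nat \<Rightarrow> real) \<Rightarrow> nat \<Rightarrow> nat \<Rightarrow> (nat \<Rightarrow> nat) \<Rightarrow> real" where
  "sq_wce \<alpha> \<gamma> N s \<xi> =
     -1 + 1 / real N * (\<Sum>k<N. \<Prod>j=1..s. wce_factor \<alpha> \<gamma> N j (\<xi> j) k)"

definition Zset :: "nat \<Rightarrow> nat \<Rightarrow> nat \<Rightarrow> nat set" where
  "Zset b m v = (if v < m then {z \<in> {1..b ^ (m - v) - 1}. gcd z (b ^ m) = 1} else {1})"

definition admissible_init :: "nat \<Rightarrow> nat \<Rightarrow> nat \<Rightarrow> (nat \<Rightarrow> nat) \<Rightarrow> (nat \<Rightarrow> nat) \<Rightarrow> bool" where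
  "admissible_init b m s w z0 \<longleftrightarrow>
     (\<forall>j\<in>{1..s}. \<exists>zb \<in> Zset b m (w j). [z0 j = b ^ w j * zb] (mod (b ^ m)))"

text \<open>
  As a supremum in \<^typ>\<open>enat\<close> this is \<open>0\<close> if already \<open>w 1 \<ge> m\<close>, and \<open>\<infinity>\<close> if \<open>w j < m\<close> for
  all \<open>j\<close>; \<open>scs_dim\<close> is the (always finite) minimum of \<open>s\<close> and \<open>s_star\<close>.
\<close>

definition s_star :: "(nat \<Rightarrow> nat) \<Rightarrow> nat \<Rightarrow> enat" where
  "s_star w m = Sup {enat j | j. j \<ge> 1 \<and> w j < m}"

definition scs_dim :: "nat \<Rightarrow> (nat \<Rightarrow> nat) \<Rightarrow> nat \<Rightarrow> nat" where
  "scs_dim s w m = the_enat (min (enat s) (s_star w m))"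

definition q_omit ::
  "real \<Rightarrow> (nat \<Rightarrow> real) \<Rightarrow> nat \<Rightarrow> nat \<Rightarrow> nat \<Rightarrow> (nat \<Rightarrow> nat) \<Rightarrow> (nat \<Rightarrow> nat) \<Rightarrow> (nat \<Rightarrow> nat)
     \<Rightarrow> nat \<Rightarrow> nat \<Rightarrow> real" where
  "q_omit \<alpha> \<gamma> b m s w z0 z d k =
     (\<Prod>j=1..<d. wce_factor \<alpha> \<gamma> (b ^ m) j (b ^ w j * z j) k) *
     (\<Prod>j=Suc d..s. wce_factor \<alpha> \<gamma> (b ^ m) j (z0 j) k)"

definition q_fold ::
  "real \<Rightarrow> (nat \<Rightarrow> real) \<Rightarrow> nat \<Rightarrow> nat \<Rightarrow> nat \<Rightarrow> (nat \<Rightarrow> nat) \<Rightarrow> (nat \<Rightarrow> nat) \<Rightarrow> (nat \<Rightarrow> nat)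
     \<Rightarrow> nat \<Rightarrow> nat \<Rightarrow> real" where
  "q_fold \<alpha> \<gamma> b m s w z0 z d k =
     (\<Sum>l<b ^ w d. q_omit \<alpha> \<gamma> b m s w z0 z d (k + l * b ^ (m - w d)))"

text \<open>The entry with index \<open>x\<close> of the product of the matrix \<open>\<Omega>\<close> with the folded vector.\<close>

definition T_val ::
  "real \<Rightarrow> (nat \<Rightarrow> real) \<Rightarrow> nat \<Rightarrow> nat \<Rightarrow> nat \<Rightarrow> (nat \<Rightarrow> nat) \<Rightarrow> (nat \<Rightarrow> nat) \<Rightarrow> (nat \<Rightarrow> nat)
     \<Rightarrow> nat \<Rightarrow> nat \<Rightarrow> real" where
  "T_val \<alpha> \<gamma> b m s w z0 z d x =
     (\<Sum>k<b ^ (m - w d). omega \<alpha> (real (k * x mod b ^ (m - w d)) / real (b ^ (m - w d)))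
        * q_fold \<alpha> \<gamma> b m s w z0 z d k)"

text \<open>
  Ties in the \<open>arg min\<close> may be broken in any way. The dividing-out step is expressed by the
  product it is meant to produce.
\<close>

definition scs_outcome ::
  "real \<Rightarrow> (nat \<Rightarrow> real) \<Rightarrow> nat \<Rightarrow> nat \<Rightarrow> nat \<Rightarrow> (nat \<Rightarrow> nat) \<Rightarrow> (nat \<Rightarrow> nat)
     \<Rightarrow> (nat \<Rightarrow> nat) \<times> real \<Rightarrow> bool" where
  "scs_outcome \<alpha> \<gamma> b m s w z0 = (\<lambda>(z, e2).
     (\<forall>d\<in>{1..scs_dim s w m}.
        is_arg_min (T_val \<alpha> \<gamma> b m s w z0 z d) (\<lambda>x. x \<in> Zset b m (w d)) (z d)) \<and>
     (\<forall>j\<in>{scs_dim s w m<..s}. z j = 1) \<and>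
     e2 = sq_wce \<alpha> \<gamma> (b ^ m) s (\<lambda>j. b ^ w j * z j))"

text \<open>
  A computation is a result together with the number of elementary operations spent on it.
  \<open>tick e\<close> charges one unit and is only ever applied to a single real, complex or integer
  operation, comparison, evaluation of a root of unity, or array access (constants depending on
  the base \<open>b\<close> only, and case distinctions on \<open>b\<close>, are free); \<open>ret\<close> is free and only passes on,
  pairs up, or selects between values that are already available. Every iteration of a loop over
  a list costs one unit on top of its body. \<open>charge\<close> is used for the given cost of evaluating
  \<open>\<omega>\<close>, and for concatenating lists.
\<close>

datatype 'a tm = TM (result: 'a) (cost: nat)

definition ret :: "'a \<Rightarrow> 'a tm" where
  "ret x = TM x 0"

definition tick :: "'a \<Rightarrow> 'a tm" where
  "tick x = TM x 1"

definition charge :: "nat \<Rightarrow> 'a \<Rightarrow> 'a tm" where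
  "charge c x = TM x c"

definition bind_tm :: "'a tm \<Rightarrow> ('a \<Rightarrow> 'b tm) \<Rightarrow> 'b tm" where
  "bind_tm t f = TM (result (f (result t))) (cost t + cost (f (result t)))"

adhoc_overloading bind \<rightleftharpoons> bind_tm

primrec map_tm :: "('a \<Rightarrow> 'b tm) \<Rightarrow> 'a list \<Rightarrow> 'b list tm" where
  "map_tm f [] = ret []"
| "map_tm f (x # xs) = do { y \<leftarrow> f x; ys \<leftarrow> map_tm f xs; tick (y # ys) }"

primrec fold_tm :: "('a \<Rightarrow> 's \<Rightarrow> 's tm) \<Rightarrow> 'a list \<Rightarrow> 's \<Rightarrow> 's tm" where
  "fold_tm f [] a = ret a"
| "fold_tm f (x # xs) a = do { a' \<leftarrow> f x a; a'' \<leftarrow> tick a'; fold_tm f xs a'' }"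

primrec iter_tm :: "('a \<Rightarrow> 'a tm) \<Rightarrow> nat \<Rightarrow> 'a \<Rightarrow> 'a list tm" where
  "iter_tm f 0 x = ret []"
| "iter_tm f (Suc n) x = do { y \<leftarrow> f x; ys \<leftarrow> iter_tm f n y; tick (x # ys) }"

definition powers_tm :: "'a::monoid_mult \<Rightarrow> nat \<Rightarrow> 'a list tm" where
  "powers_tm v n = iter_tm (\<lambda>u. tick (u * v)) n 1"

primrec power_tm :: "'a::monoid_mult \<Rightarrow> nat \<Rightarrow> 'a tm" where
  "power_tm v 0 = ret 1"
| "power_tm v (Suc n) = do { u \<leftarrow> power_tm v n; tick (u * v) }"

definition read :: "'a list \<Rightarrow> nat \<Rightarrow> 'a tm" where
  "read xs i = tick (xs ! i)"

text \<open>Horner's scheme: \<open>\<Sum>i. (xs ! i) * v ^ i\<close>.\<close>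

primrec horner_tm :: "complex \<Rightarrow> complex list \<Rightarrow> complex tm" where
  "horner_tm v [] = ret 0"
| "horner_tm v (x # xs) = do { h \<leftarrow> horner_tm v xs; p \<leftarrow> tick (v * h); tick (x + p) }"

text \<open>
  Mixed-radix (Cooley-Tukey) transform. If \<open>w\<close> is a primitive \<open>N\<close>-th root of unity, where
  \<open>N = r * p ^ e\<close> and \<open>length xs = N\<close>, the result is \<open>\<Sum>i<N. xs ! i * w ^ (i * k)\<close> for
  \<open>k = 0, \<dots>, N - 1\<close>: \<open>e\<close> decimation steps of radix \<open>p\<close>, followed by plain transforms of
  length \<open>r\<close>.
\<close>

primrec fft_tm :: "nat \<Rightarrow> nat \<Rightarrow> nat \<Rightarrow> complex \<Rightarrow> complex list \<Rightarrow> complex list tm" where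
  "fft_tm p 0 N w xs = do { vs \<leftarrow> powers_tm w N; map_tm (\<lambda>v. horner_tm v xs) vs }"
| "fft_tm p (Suc e) N w xs = do {
     n \<leftarrow> tick (N div p);
     w' \<leftarrow> power_tm w p;
     Xs \<leftarrow> map_tm (\<lambda>c. do {
         ys \<leftarrow> map_tm (\<lambda>i. do { i1 \<leftarrow> tick (p * i); i2 \<leftarrow> tick (i1 + c); read xs i2 }) [0..<n];
         fft_tm p e n w' ys }) [0..<p];
     vs \<leftarrow> powers_tm w N;
     map_tm (\<lambda>k. do {
         v \<leftarrow> read vs k;
         k' \<leftarrow> tick (k mod n);
         col \<leftarrow> map_tm (\<lambda>X. read X k') Xs;
         horner_tm v col }) [0..<N] }"

text \<open>
  Product of the circulant matrix with first column \<open>xs\<close> and the vector \<open>ys\<close>, both of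
  length \<open>N = r * p ^ e\<close>, i.e.\ the cyclic convolution of \<open>xs\<close> and \<open>ys\<close>.
\<close>

definition circulant_mult_tm :: "nat \<Rightarrow> nat \<Rightarrow> nat \<Rightarrow> real list \<Rightarrow> real list \<Rightarrow> real list tm" where
  "circulant_mult_tm p e N xs ys = do {
     cx \<leftarrow> map_tm (\<lambda>x. tick (complex_of_real x)) xs;
     cy \<leftarrow> map_tm (\<lambda>y. tick (complex_of_real y)) ys;
     w \<leftarrow> tick (cis (2 * pi / real N));
     X \<leftarrow> fft_tm p e N w cx;
     Y \<leftarrow> fft_tm p e N w cy;
     P \<leftarrow> map_tm (\<lambda>i. do { x \<leftarrow> read X i; y \<leftarrow> read Y i; tick (x * y) }) [0..<N];
     w' \<leftarrow> tick (inverse w);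
     U \<leftarrow> fft_tm p e N w' P;
     map_tm (\<lambda>u. do { v \<leftarrow> tick (u / of_nat N); tick (Re v) }) U }"

text \<open>
  For every \<open>l \<ge> 1\<close> the group of units modulo \<open>b ^ l\<close>, taken modulo sign, is cyclic and generated
  by \<open>unit_gen b\<close>, which depends only on the fixed base \<open>b\<close>; its order is \<open>half_order b l\<close>,
  and \<open>radix_exp b l\<close> is an exponent \<open>e\<close> such that \<open>b ^ e\<close> divides this order. Truncated
  subtraction makes the order \<open>1\<close> for the moduli \<open>2\<close> and \<open>4\<close>.
\<close>

definition unit_gen :: "nat \<Rightarrow> nat" where
  "unit_gen b = (if b = 2 then 5 else (LEAST g. \<forall>l\<ge>1. residue_primroot (b ^ l) g))"

definition radix_exp :: "nat \<Rightarrow> nat \<Rightarrow> nat" where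
  "radix_exp b l = (if b = 2 then l - 2 else l - 1)"

definition half_order :: "nat \<Rightarrow> nat \<Rightarrow> nat" where
  "half_order b l = (if b = 2 then 1 else (b - 1) div 2) * b ^ radix_exp b l"

text \<open>In the following, \<open>bp\<close> is the table of the powers \<open>b ^ 0, \<dots>, b ^ m\<close>.\<close>

definition half_order_tm :: "nat \<Rightarrow> nat list \<Rightarrow> nat \<Rightarrow> nat tm" where
  "half_order_tm b bp l = do {
     e \<leftarrow> tick (radix_exp b l);
     x \<leftarrow> read bp e;
     tick ((if b = 2 then 1 else (b - 1) div 2) * x) }"

text \<open>The powers \<open>g ^ 0, g ^ 1, \<dots>\<close> of the generator modulo \<open>b ^ l\<close>.\<close>

definition units_tm :: "nat \<Rightarrow> nat list \<Rightarrow> nat \<Rightarrow> nat list tm" where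
  "units_tm b bp l = do {
     M \<leftarrow> read bp l;
     r \<leftarrow> half_order_tm b bp l;
     iter_tm (\<lambda>v. do { x \<leftarrow> tick (v * unit_gen b); tick (x mod M) }) r 1 }"

text \<open>
  The block for \<open>l\<close> collects the columns \<open>k\<close> of \<open>\<Omega>\<close> (of size parameter \<open>b ^ n\<close>) with
  \<open>gcd k (b ^ n) = b ^ (n - l)\<close>, i.e.\ \<open>k = b ^ (n - l) * u\<close> with \<open>u\<close> a unit modulo \<open>b ^ l\<close>.
  Columns \<open>u\<close> and \<open>- u\<close> coincide by the symmetry of \<open>\<omega>\<close> and are merged (for \<open>b ^ l = 2\<close> they are
  the same column). With rows ordered as \<open>g ^ i\<close> and columns as \<open>g ^ (- j)\<close>
  the block is circulant of order \<open>half_order b l\<close>, and repeated along the rows. Here \<open>tab\<close> is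
  the table of \<open>\<omega> (k / b ^ m)\<close> and \<open>q\<close> the vector to be multiplied.
\<close>

definition block_tm ::
  "nat \<Rightarrow> nat list \<Rightarrow> nat \<Rightarrow> nat \<Rightarrow> real list \<Rightarrow> real list \<Rightarrow> nat \<Rightarrow> (nat \<times> real list) tm" where
  "block_tm b bp m n tab q l = do {
     M \<leftarrow> read bp l;
     nl \<leftarrow> tick (n - l);
     shift \<leftarrow> read bp nl;
     ml \<leftarrow> tick (m - l);
     stride \<leftarrow> read bp ml;
     r \<leftarrow> half_order_tm b bp l;
     us \<leftarrow> units_tm b bp l;
     as \<leftarrow> map_tm (\<lambda>u. do { i \<leftarrow> tick (u * stride); read tab i }) us;
     ps \<leftarrow> map_tm (\<lambda>j. do {
         j1 \<leftarrow> tick (r - j);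
         j2 \<leftarrow> tick (j1 mod r);
         u \<leftarrow> read us j2;
         i1 \<leftarrow> tick (u * shift);
         x1 \<leftarrow> read q i1;
         u' \<leftarrow> tick (M - u);
         i2 \<leftarrow> tick (u' * shift);
         x2 \<leftarrow> read q i2;
         c \<leftarrow> tick (M = 2);
         if c then ret x1 else tick (x1 + x2) }) [0..<r];
     e \<leftarrow> tick (radix_exp b l);
     C \<leftarrow> circulant_mult_tm b e r as ps;
     ret (r, C) }"

text \<open>The result lists the pairs \<open>(z, T z)\<close> with \<open>z\<close> running through the units modulo \<open>b ^ n\<close>.\<close>

definition omega_mult_tm ::
  "nat \<Rightarrow> nat list \<Rightarrow> nat \<Rightarrow> nat \<Rightarrow> real list \<Rightarrow> real list \<Rightarrow> (nat \<times> real) list tm" where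
  "omega_mult_tm b bp m n tab q = do {
     x0 \<leftarrow> read tab 0;
     y0 \<leftarrow> read q 0;
     c0 \<leftarrow> tick (x0 * y0);
     blocks \<leftarrow> map_tm (block_tm b bp m n tab q) [1..<Suc n];
     M \<leftarrow> read bp n;
     r \<leftarrow> half_order_tm b bp n;
     us \<leftarrow> units_tm b bp n;
     pos \<leftarrow> map_tm (\<lambda>i. do {
         u \<leftarrow> read us i;
         t \<leftarrow> fold_tm (\<lambda>(r', C) a. do {
             i' \<leftarrow> tick (i mod r');
             x \<leftarrow> read C i';
             tick (a + x) }) blocks c0;
         ret (u, t) }) [0..<r];
     neg \<leftarrow> map_tm (\<lambda>(u, t). do { u' \<leftarrow> tick (M - u); ret (u', t) }) pos;
     charge (length pos) (pos @ neg) }"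

definition argmin_tm :: "(nat \<times> real) list \<Rightarrow> nat tm" where
  "argmin_tm xs = do {
     x0 \<leftarrow> read xs 0;
     p \<leftarrow> fold_tm (\<lambda>x y. do { c \<leftarrow> tick (snd x < snd y); ret (if c then x else y) }) xs x0;
     ret (fst p) }"

definition factor_tm ::
  "(nat \<Rightarrow> real) \<Rightarrow> nat \<Rightarrow> real list \<Rightarrow> nat \<Rightarrow> nat \<Rightarrow> nat \<Rightarrow> real tm" where
  "factor_tm \<gamma> N tab j \<xi> k = do {
     a \<leftarrow> tick (k * \<xi>);
     i \<leftarrow> tick (a mod N);
     x \<leftarrow> read tab i;
     g \<leftarrow> tick (\<gamma> j);
     p \<leftarrow> tick (g * x);
     tick (1 + p) }"

text \<open>
  Started with \<open>active_tm w m s 1\<close>, the scan returns the largest \<open>d \<le> s\<close> with \<open>w d < m\<close> (and \<open>0\<close>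
  if there is none), which is \<open>scs_dim s w m\<close> for nondecreasing \<open>w\<close>.
\<close>

primrec active_tm :: "(nat \<Rightarrow> nat) \<Rightarrow> nat \<Rightarrow> nat \<Rightarrow> nat \<Rightarrow> nat tm" where
  "active_tm w m 0 d = tick (d - 1)"
| "active_tm w m (Suc f) d = do {
     v \<leftarrow> tick (w d);
     c \<leftarrow> tick (v < m);
     if c then do { d' \<leftarrow> tick (d + 1); active_tm w m f d' } else tick (d - 1) }"

text \<open>
  The factors of the coordinates beyond \<open>n = min s s_star\<close> are \<open>1 + \<gamma> j * \<omega> 0\<close> throughout.
  Their product does not depend on \<open>k\<close>, on the initial vector or on the search; it is a constant
  of the weighted space and is not charged. (Even reading the weights with index in \<open>{n<..s}\<close>
  takes \<open>s - n\<close> operations, which no bound independent of \<open>s\<close> for \<open>s > s_star\<close> can cover.)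
\<close>

definition tail_const :: "(nat \<Rightarrow> real) \<Rightarrow> nat \<Rightarrow> nat \<Rightarrow> real \<Rightarrow> real" where
  "tail_const \<gamma> n s x = (\<Prod>j\<in>{n<..s}. 1 + \<gamma> j * x)"

definition init_q_tm ::
  "(nat \<Rightarrow> real) \<Rightarrow> nat \<Rightarrow> real list \<Rightarrow> nat \<Rightarrow> real \<Rightarrow> (nat \<Rightarrow> nat) \<Rightarrow> real list tm" where
  "init_q_tm \<gamma> N tab n t z0 =
     map_tm (\<lambda>k. fold_tm (\<lambda>j v. do {
         c \<leftarrow> tick (z0 j);
         f \<leftarrow> factor_tm \<gamma> N tab j c k;
         tick (v * f) }) [1..<Suc n] t) [0..<N]"

definition divide_out_tm ::
  "(nat \<Rightarrow> real) \<Rightarrow> nat \<Rightarrow> real list \<Rightarrow> nat \<Rightarrow> nat \<Rightarrow> real list \<Rightarrow> real list tm" where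
  "divide_out_tm \<gamma> N tab d \<xi> q =
     map_tm (\<lambda>k. do { f \<leftarrow> factor_tm \<gamma> N tab d \<xi> k; v \<leftarrow> read q k; tick (v / f) }) [0..<N]"

definition multiply_in_tm ::
  "(nat \<Rightarrow> real) \<Rightarrow> nat \<Rightarrow> real list \<Rightarrow> nat \<Rightarrow> nat \<Rightarrow> real list \<Rightarrow> real list tm" where
  "multiply_in_tm \<gamma> N tab d \<xi> q =
     map_tm (\<lambda>k. do { f \<leftarrow> factor_tm \<gamma> N tab d \<xi> k; v \<leftarrow> read q k; tick (v * f) }) [0..<N]"

definition fold_pieces_tm :: "nat \<Rightarrow> nat \<Rightarrow> real list \<Rightarrow> real list tm" where
  "fold_pieces_tm Y M q =
     map_tm (\<lambda>k. fold_tm (\<lambda>l a. do {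
         i \<leftarrow> tick (l * M);
         i' \<leftarrow> tick (k + i);
         x \<leftarrow> read q i';
         tick (a + x) }) [0..<Y] 0) [0..<M]"

definition scs_step_tm ::
  "(nat \<Rightarrow> real) \<Rightarrow> nat \<Rightarrow> nat \<Rightarrow> nat list \<Rightarrow> nat \<Rightarrow> real list \<Rightarrow> (nat \<Rightarrow> nat) \<Rightarrow> (nat \<Rightarrow> nat)
     \<Rightarrow> nat \<Rightarrow> real list \<times> (nat \<Rightarrow> nat) \<Rightarrow> (real list \<times> (nat \<Rightarrow> nat)) tm" where
  "scs_step_tm \<gamma> b m bp N tab w z0 d = (\<lambda>(q, z). do {
     v \<leftarrow> tick (w d);
     n \<leftarrow> tick (m - v);
     Y \<leftarrow> read bp v;
     M \<leftarrow> read bp n;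
     \<xi>0 \<leftarrow> tick (z0 d);
     qd \<leftarrow> divide_out_tm \<gamma> N tab d \<xi>0 q;
     q' \<leftarrow> fold_pieces_tm Y M qd;
     T \<leftarrow> omega_mult_tm b bp m n tab q';
     zd \<leftarrow> argmin_tm T;
     z' \<leftarrow> tick (z(d := zd));
     \<xi> \<leftarrow> tick (Y * zd);
     q'' \<leftarrow> multiply_in_tm \<gamma> N tab d \<xi> qd;
     ret (q'', z') })"

text \<open>
  \<open>cw N\<close> is the cost of evaluating \<open>\<omega>\<close> at \<open>N\<close> distinct arguments. The vector \<open>z\<close> is initialised
  to \<open>1\<close>, which already sets the components beyond \<open>min s s_star\<close>.
\<close>

definition reduced_fast_scs ::
  "real \<Rightarrow> (nat \<Rightarrow> nat) \<Rightarrow> (nat \<Rightarrow> real) \<Rightarrow> nat \<Rightarrow> nat \<Rightarrow> nat \<Rightarrow> (nat \<Rightarrow> nat) \<Rightarrow> (nat \<Rightarrow> nat)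
     \<Rightarrow> ((nat \<Rightarrow> nat) \<times> real) tm" where
  "reduced_fast_scs \<alpha> cw \<gamma> b m s w z0 = do {
     bp \<leftarrow> powers_tm b (m + 1);
     N \<leftarrow> read bp m;
     tab \<leftarrow> charge (cw N) (map (\<lambda>k. omega \<alpha> (real k / real N)) [0..<N]);
     n \<leftarrow> active_tm w m s 1;
     x0 \<leftarrow> read tab 0;
     q \<leftarrow> init_q_tm \<gamma> N tab n (tail_const \<gamma> n s x0) z0;
     (q', z) \<leftarrow> fold_tm (scs_step_tm \<gamma> b m bp N tab w z0) [1..<Suc n] (q, \<lambda>_. 1);
     S \<leftarrow> fold_tm (\<lambda>x a. tick (a + x)) q' 0;
     a \<leftarrow> tick (S / real N);
     e2 \<leftarrow> tick (-1 + a);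
     ret (z, e2) }"

end

theory Submission
  imports Defs
begin

text \<open>
  For \<open>l \<ge> 1\<close> the powers of \<open>unit_gen b\<close> with exponents below \<open>half_order b l\<close>, together with their
  negatives, run exactly once through the units modulo \<open>b ^ l\<close> (unless \<open>b ^ l = 2\<close>). Since
  \<open>\<omega> (1 - x) = \<omega> x\<close>, a row of \<open>\<Omega>\<close> only depends on its index modulo sign, and after splitting the
  columns by their valuation each block of \<open>\<Omega>\<close> becomes a circulant matrix of order \<open>half_order b l\<close>.
  This order is \<open>b ^ radix_exp b l\<close> times a factor bounded in terms of \<open>b\<close>, so the radix \<open>b\<close>
  transform multiplies the block by a vector in \<open>O(l b ^ l)\<close> operations. The block orders grow
  geometrically, so the matrix-vector product of step \<open>d\<close> costs \<open>O((m - w d) b ^ (m - w d))\<close>, and all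
  other work of a step is linear in \<open>b ^ m\<close>. Correctness of the search is the loop invariant
  that the stored vector is the product of the factors chosen so far and the initial ones not yet
  replaced.
\<close>

section \<open>Cost monad\<close>

text \<open>Working modulo sign is what lets one construction serve every base. For
  \<open>b = 2\<close> the units modulo \<open>2 ^ l\<close> are not cyclic once
  \<open>l >= 3\<close>, but each is plus or minus a power of 5; for odd \<open>b\<close> the
  element -1 is itself a power of the primitive root, namely the one at half the order. Reducing
  exponents modulo \<open>half_order b l\<close> therefore changes a unit at most by a sign, which
  \<omega> does not see. The modulus 2, where 1 and -1 coincide, has to be singled out whenever
  units are counted.

  Operation counts depend on lengths and integer parameters, never on the real numbers stored. Hence
  the cost bound is unconditional, whereas correctness needs the factors divided out to be nonzero.
  Each of these belongs to the initial vector, since a coordinate is divided out just before it is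
  replaced. Coordinates beyond \<open>scs_dim s w m\<close> are 0 modulo \<open>b ^ m\<close>, which
  is why the cost stops growing with \<open>s\<close> there.\<close>

lemma result_bind_tm [simp]: "result (bind_tm t f) = result (f (result t))"
  and cost_bind_tm [simp]: "cost (bind_tm t f) = cost t + cost (f (result t))"
  by (simp_all add: bind_tm_def)

lemma result_ret [simp]: "result (ret x) = x" and cost_ret [simp]: "cost (ret x) = 0"
  by (simp_all add: ret_def)

lemma result_tick [simp]: "result (tick x) = x" and cost_tick [simp]: "cost (tick x) = 1"
  by (simp_all add: tick_def)

lemma result_charge [simp]: "result (charge c x) = x" and cost_charge [simp]: "cost (charge c x) = c"
  by (simp_all add: charge_def)

lemma result_read [simp]: "result (read xs i) = xs ! i" and cost_read [simp]: "cost (read xs i) = 1"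
  by (simp_all add: read_def)

lemma result_map_tm [simp]: "result (map_tm f xs) = map (\<lambda>x. result (f x)) xs"
  by (induction xs) auto

lemma cost_map_tm: "cost (map_tm f xs) = (\<Sum>x\<leftarrow>xs. cost (f x) + 1)"
  by (induction xs) auto

lemma cost_map_tm_const:
  assumes "\<And>x. x \<in> set xs \<Longrightarrow> cost (f x) = c"
  shows "cost (map_tm f xs) = length xs * (c + 1)"
  using assms by (induction xs) auto

lemma cost_map_tm_le:
  assumes "\<And>x. x \<in> set xs \<Longrightarrow> cost (f x) \<le> c"
  shows "cost (map_tm f xs) \<le> length xs * (c + 1)"
  using assms
proof (induction xs)
  case (Cons x xs)
  then have "cost (map_tm f xs) \<le> length xs * (c + 1)" "cost (f x) \<le> c" by auto
  then show ?case by simp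
qed simp

lemma result_fold_tm: "result (fold_tm f xs a) = fold (\<lambda>x a. result (f x a)) xs a"
  by (induction xs arbitrary: a) auto

lemma cost_fold_tm_const:
  assumes "\<And>x a. x \<in> set xs \<Longrightarrow> cost (f x a) = c"
  shows "cost (fold_tm f xs a) = length xs * (c + 1)"
  using assms by (induction xs arbitrary: a) auto

lemma cost_fold_tm_le:
  assumes "P a"
    and "\<And>x a. x \<in> set xs \<Longrightarrow> P a \<Longrightarrow> P (result (f x a))"
    and "\<And>x a. x \<in> set xs \<Longrightarrow> P a \<Longrightarrow> cost (f x a) \<le> c x"
  shows "cost (fold_tm f xs a) \<le> (\<Sum>x\<leftarrow>xs. c x + 1)"
  using assms
proof (induction xs arbitrary: a)
  case (Cons x xs)
  have "cost (fold_tm f xs (result (f x a))) \<le> (\<Sum>x\<leftarrow>xs. c x + 1)"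
    by (rule Cons.IH) (use Cons.prems in auto)
  moreover have "cost (f x a) \<le> c x" using Cons.prems by simp
  ultimately show ?case by simp
qed simp

lemma length_result_iter_tm [simp]: "length (result (iter_tm f n x)) = n"
  by (induction n arbitrary: x) auto

lemma nth_result_iter_tm: "i < n \<Longrightarrow> result (iter_tm f n x) ! i = ((\<lambda>x. result (f x)) ^^ i) x"
proof (induction n arbitrary: x i)
  case (Suc n)
  \<comment> \<open>\<open>iter_tm\<close> applies \<open>f\<close> to the start value first, so the
    power is unfolded at its innermost application.\<close>
  then show ?case by (cases i) (auto simp del: funpow.simps simp: funpow_Suc_right)
qed simp

lemma cost_iter_tm_const:
  assumes "\<And>x. cost (f x) = c"
  shows "cost (iter_tm f n x) = n * (c + 1)"
  using assms by (induction n arbitrary: x) auto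

lemma result_powers_tm [simp]: "result (powers_tm v n) = map (\<lambda>i. v ^ i) [0..<n]"
proof -
  have "((\<lambda>u. u * v) ^^ i) 1 = v ^ i" for i
    by (induction i) (auto simp: power_commutes)
  then show ?thesis
    by (intro nth_equalityI) (auto simp: powers_tm_def nth_result_iter_tm)
qed

lemma cost_powers_tm [simp]: "cost (powers_tm v n) = 2 * n"
  by (simp add: powers_tm_def cost_iter_tm_const[where c = 1])

lemma result_power_tm [simp]: "result (power_tm v n) = v ^ n"
  by (induction n) (auto simp: power_commutes)

lemma cost_power_tm [simp]: "cost (power_tm v n) = n"
  by (induction n) auto

lemma result_horner_tm [simp]: "result (horner_tm v xs) = (\<Sum>i<length xs. xs ! i * v ^ i)"
proof (induction xs)
  case (Cons x xs)
  then show ?case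
    by (simp add: sum.lessThan_Suc_shift sum_distrib_left mult_ac del: sum.lessThan_Suc)
qed simp

lemma cost_horner_tm [simp]: "cost (horner_tm v xs) = 2 * length xs"
  by (induction xs) auto

section \<open>Fast Fourier transform and circulant matrices\<close>

text \<open>Division with remainder by \<open>p\<close>: grouping the indices by their residue
  \<open>c\<close> is the decimation step of the transform.\<close>

lemma sum_radix:
  fixes f :: "nat \<Rightarrow> 'a::comm_monoid_add"
  assumes "p > 0"
  shows "(\<Sum>i<p * n. f i) = (\<Sum>c<p. \<Sum>i<n. f (p * i + c))"
proof -
  have "(\<Sum>i<p * n. f i) = (\<Sum>(c, i)\<in>{..<p} \<times> {..<n}. f (p * i + c))"
  proof (rule sum.reindex_bij_witness[of _ "\<lambda>(c, i). p * i + c" "\<lambda>k. (k mod p, k div p)"])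
    fix a assume "a \<in> {..<p * n}"
    then show "(a mod p, a div p) \<in> {..<p} \<times> {..<n}"
      using assms by (auto simp: less_mult_imp_div_less mult.commute)
  next
    fix ci assume "ci \<in> {..<p} \<times> {..<n}"
    moreover obtain c i where "ci = (c, i)" by fastforce
    ultimately have *: "c < p" "i < n" "ci = (c, i)" by auto
    have "p * i + c < p * (i + 1)" using * by simp
    also have "\<dots> \<le> p * n" using * by (intro mult_le_mono2) simp
    finally show "(case ci of (c, i) \<Rightarrow> p * i + c) \<in> {..<p * n}"
      using * by simp
  qed (use assms in auto)
  also have "\<dots> = (\<Sum>c<p. \<Sum>i<n. f (p * i + c))"
    by (simp add: sum.cartesian_product)
  finally show ?thesis .
qed

text \<open>Grouping the inputs by index modulo \<open>p\<close> turns each output into a polynomial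
  of degree below \<open>p\<close> in \<open>w ^ k\<close> whose coefficients are outputs of the
  \<open>p\<close> shorter transforms. The identity is purely algebraic, so it serves the forward
  transform and the one with \<open>inverse w\<close> alike.\<close>

lemma result_fft_tm:
  assumes "N = r * p ^ e" "p > 0" "length xs = N" "w ^ N = 1"
  shows "result (fft_tm p e N w xs) = map (\<lambda>k. \<Sum>i<N. xs ! i * w ^ (i * k)) [0..<N]"
  using assms
proof (induction e arbitrary: N w xs)
  case 0
  then show ?case by (simp add: power_mult[symmetric] mult.commute)
next
  case (Suc e)
  define n where "n = r * p ^ e"
  have N: "N = p * n" and Ndiv: "N div p = n"
    using Suc.prems by (auto simp: n_def)
  have wn: "(w ^ p) ^ n = 1"
    using Suc.prems(4) by (simp add: N power_mult)
  have IH: "result (fft_tm p e n (w ^ p) (map (\<lambda>i. xs ! (p * i + c)) [0..<n]))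
      = map (\<lambda>k. \<Sum>i<n. xs ! (p * i + c) * (w ^ p) ^ (i * k)) [0..<n]" for c
    using Suc.prems wn by (subst Suc.IH) (auto simp: n_def)
  \<comment> \<open>The powers of \<open>w ^ p\<close> have period \<open>n\<close>, so the shorter
    transforms are needed only at \<open>k mod n\<close>; this is where the saving lies.\<close>
  have pm: "(w ^ p) ^ (i * (k mod n)) = w ^ (p * i * k)" for i k
  proof -
    have "(w ^ p) ^ k = (w ^ p) ^ (k mod n + n * (k div n))" by simp
    also have "\<dots> = (w ^ p) ^ (k mod n)"
      by (simp only: power_add power_mult wn power_one mult_1_right)
    finally have "((w ^ p) ^ k) ^ i = ((w ^ p) ^ (k mod n)) ^ i" by simp
    then show ?thesis by (simp add: mult_ac flip: power_mult)
  qed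
  show ?case
  proof (intro nth_equalityI)
    show "length (result (fft_tm p (Suc e) N w xs)) =
          length (map (\<lambda>k. \<Sum>i<N. xs ! i * w ^ (i * k)) [0..<N])" by simp
  next
    fix k assume "k < length (result (fft_tm p (Suc e) N w xs))"
    then have k: "k < N" by simp
    then have n0: "n > 0" using N by (cases n) auto
    have "(\<Sum>i<N. xs ! i * w ^ (i * k))
        = (\<Sum>c<p. (\<Sum>i<n. xs ! (p * i + c) * (w ^ p) ^ (i * (k mod n))) * (w ^ k) ^ c)"
    proof -
      have "(\<Sum>i<N. xs ! i * w ^ (i * k)) = (\<Sum>c<p. \<Sum>i<n. xs ! (p * i + c) * w ^ ((p * i + c) * k))"
        unfolding N by (rule sum_radix) (use Suc.prems in simp)
      also have "\<dots> = (\<Sum>c<p. \<Sum>i<n. xs ! (p * i + c) * (w ^ p) ^ (i * (k mod n)) * (w ^ k) ^ c)"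
      proof (intro sum.cong refl)
        fix c i
        have "w ^ ((p * i + c) * k) = w ^ (p * i * k) * (w ^ k) ^ c"
          by (simp add: distrib_right power_add mult.commute[of c] flip: power_mult)
        then show "xs ! (p * i + c) * w ^ ((p * i + c) * k)
            = xs ! (p * i + c) * (w ^ p) ^ (i * (k mod n)) * (w ^ k) ^ c"
          by (simp add: pm mult.assoc)
      qed
      finally show ?thesis by (simp add: sum_distrib_right)
    qed
    then show "result (fft_tm p (Suc e) N w xs) ! k =
        map (\<lambda>k. \<Sum>i<N. xs ! i * w ^ (i * k)) [0..<N] ! k"
      using k n0 by (simp add: Ndiv IH)
  qed
qed

lemma length_result_fft_tm [simp]: "length (result (fft_tm p e N w xs)) = N"
  by (cases e) auto

text \<open>Each level costs \<open>12 + 4 * p\<close> per entry: 4 for extracting the subsequences,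
  2 for the table of powers, \<open>4 * p + 3\<close> for recombination, and 3 to absorb the
  remaining \<open>1 + 2 * p\<close>. The term \<open>2 * r + 3\<close> is the plain transform of
  length \<open>r\<close> at the bottom.\<close>

lemma cost_fft_tm_le:
  assumes "N = r * p ^ e" "p > 0" "r > 0" "length xs = N"
  shows "cost (fft_tm p e N w xs) \<le> N * (2 * r + 3 + (12 + 4 * p) * e)"
  using assms
proof (induction e arbitrary: N w xs)
  case 0
  then show ?case by (simp add: cost_map_tm_const[where c = "2 * r"] algebra_simps)
next
  case (Suc e)
  define n where "n = r * p ^ e"
  have N: "N = p * n" and Ndiv: "N div p = n"
    using Suc.prems by (auto simp: n_def)
  have "n > 0" using Suc.prems by (simp add: n_def)
  let ?K = "2 * r + 3 + (12 + 4 * p) * e"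
  let ?ys = "\<lambda>c. map_tm (\<lambda>i. bind_tm (tick (p * i)) (\<lambda>i1. bind_tm (tick (i1 + c)) (read xs))) [0..<n]"
  let ?body = "\<lambda>c. bind_tm (?ys c) (fft_tm p e n (w ^ p))"
  have ys: "cost (?ys c) = 4 * n" for c
    by (subst cost_map_tm_const[where c = 3]) auto
  have body: "cost (?body c) \<le> 4 * n + n * ?K" for c
    using Suc.IH[of n "map (\<lambda>i. xs ! (p * i + c)) [0..<n]" "w ^ p"] Suc.prems
    by (simp add: ys comp_def flip: n_def)
  have Xs: "cost (map_tm ?body [0..<p]) \<le> p * (4 * n + n * ?K + 1)"
    using cost_map_tm_le[of "[0..<p]" ?body "4 * n + n * ?K"] body by simp
  have col: "cost (map_tm (\<lambda>X. read X k') (result (map_tm ?body [0..<p]))) = 2 * p" for k'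
    by (subst cost_map_tm_const[where c = 1]) auto
  have "cost (fft_tm p (Suc e) N w xs) = 1 + p + cost (map_tm ?body [0..<p]) + 2 * N + N * (4 * p + 3)"
    unfolding fft_tm.simps
    by (simp add: Ndiv cost_map_tm_const[where c = "4 * p + 2"] cost_map_tm_const[where c = 1] comp_def distrib_left)
  also have "\<dots> \<le> 1 + p + p * (4 * n + n * ?K + 1) + 2 * N + N * (4 * p + 3)"
    using Xs by simp
  also have "\<dots> = 1 + 2 * p + 9 * N + N * 4 * p + N * ?K"
    by (simp add: N algebra_simps)
  also have "\<dots> \<le> 3 * N + 9 * N + N * 4 * p + N * ?K"
  proof -
    have "p \<le> N" "1 \<le> N" using Suc.prems \<open>n > 0\<close> by (auto simp: N)
    then show ?thesis by (simp add: algebra_simps)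
  qed
  finally show ?case by (simp add: algebra_simps)
qed

section \<open>Roots of unity and cyclic convolution\<close>

lemma sum_powers_root_unity:
  fixes v :: complex
  assumes "v ^ N = 1" "N > 0"
  shows "(\<Sum>k<N. v ^ k) = (if v = 1 then of_nat N else 0)"
  using assms by (simp add: geometric_sum)

lemma cis_root_power: "cis (2 * pi / real N) ^ k = cis (2 * pi * real k / real N)"
  by (subst Complex.DeMoivre) (simp add: mult_ac)

lemma cis_root_power_eq_iff:
  assumes "N > 0"
  shows "cis (2 * pi / real N) ^ j = cis (2 * pi / real N) ^ k \<longleftrightarrow> [j = k] (mod N)"
proof -
  have "cis (2 * pi * real k / real N) = exp (2 * complex_of_real pi * \<i> * complex_of_nat k / complex_of_nat N)" for k
    by (simp add: cis_conv_exp mult_ac)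
  then show ?thesis
    using complex_root_unity_eq[of N j k] assms by (simp add: cis_root_power cong_def)
qed

text \<open>The convolution theorem: transforming the pointwise product back singles out the index
  pairs with \<open>a + c = i\<close> modulo \<open>N\<close>. The index
  \<open>(i + (N - j)) mod N\<close> is \<open>i - j\<close> modulo \<open>N\<close>, written
  without truncation.\<close>

lemma result_circulant_mult_tm:
  assumes N: "N = r * p ^ e" "p > 0" "N > 0" and len: "length xs = N" "length ys = N"
  shows "result (circulant_mult_tm p e N xs ys) =
    map (\<lambda>i. \<Sum>j<N. xs ! ((i + (N - j)) mod N) * ys ! j) [0..<N]"
proof -
  define w where "w = cis (2 * pi / real N)"
  have wN: "w ^ N = 1"
    using cis_root_power_eq_iff[of N N 0] \<open>N > 0\<close> by (simp add: w_def cong_def)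
  have "w \<noteq> 0" by (simp add: w_def)
  \<comment> \<open>Primitivity of \<open>w\<close> enters here: the ratio of this geometric sum is
    1 exactly when \<open>a + c\<close> and \<open>i\<close> agree modulo \<open>N\<close>.\<close>
  have orth: "(\<Sum>k<N. w ^ (a * k) * w ^ (c * k) * inverse w ^ (k * i))
      = (if [a + c = i] (mod N) then of_nat N else 0)" for a c i
  proof -
    have "(\<Sum>k<N. w ^ (a * k) * w ^ (c * k) * inverse w ^ (k * i)) = (\<Sum>k<N. (w ^ a * w ^ c * inverse w ^ i) ^ k)"
      by (simp add: power_mult_distrib mult.commute[of _ i] flip: power_mult)
    moreover have "(w ^ a * w ^ c * inverse w ^ i) ^ N = 1"
    proof -
      have "(w ^ a * w ^ c * inverse w ^ i) ^ N = (w ^ N) ^ a * (w ^ N) ^ c * inverse ((w ^ N) ^ i)"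
        by (simp add: power_mult_distrib power_inverse mult.commute flip: power_mult)
      then show ?thesis by (simp add: wN)
    qed
    moreover have "w ^ a * w ^ c * inverse w ^ i = 1 \<longleftrightarrow> [a + c = i] (mod N)"
    proof -
      have "w ^ a * w ^ c * inverse w ^ i = 1 \<longleftrightarrow> w ^ (a + c) = w ^ i"
        using \<open>w \<noteq> 0\<close> by (simp add: power_inverse power_add field_simps)
      then show ?thesis using cis_root_power_eq_iff[of N "a + c" i] \<open>N > 0\<close> by (simp add: w_def)
    qed
    ultimately show ?thesis using \<open>N > 0\<close> by (simp add: sum_powers_root_unity)
  qed
  have conv: "(\<Sum>k<N. (\<Sum>a<N. complex_of_real (xs ! a) * w ^ (a * k)) * (\<Sum>c<N. complex_of_real (ys ! c) * w ^ (c * k))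
        * inverse w ^ (k * i))
      = of_nat N * complex_of_real (\<Sum>j<N. xs ! ((i + (N - j)) mod N) * ys ! j)" (is "?lhs = ?rhs")
    for i
  proof -
    have "?lhs = (\<Sum>k<N. \<Sum>c<N. \<Sum>a<N. complex_of_real (xs ! a * ys ! c) * (w ^ (a * k) * w ^ (c * k) * inverse w ^ (k * i)))"
      by (intro sum.cong refl, subst sum_product, subst sum.swap)
         (simp add: sum_distrib_right sum_distrib_left mult_ac)
    also have "\<dots> = (\<Sum>c<N. \<Sum>k<N. \<Sum>a<N. complex_of_real (xs ! a * ys ! c) * (w ^ (a * k) * w ^ (c * k) * inverse w ^ (k * i)))"
      by (rule sum.swap)
    also have "\<dots> = (\<Sum>c<N. \<Sum>a<N. \<Sum>k<N. complex_of_real (xs ! a * ys ! c) * (w ^ (a * k) * w ^ (c * k) * inverse w ^ (k * i)))"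
      by (intro sum.cong refl sum.swap)
    also have "\<dots> = (\<Sum>c<N. \<Sum>a<N. if [a + c = i] (mod N) then of_nat N * complex_of_real (xs ! a * ys ! c) else 0)"
      by (intro sum.cong refl) (simp add: orth flip: sum_distrib_left)
    also have "\<dots> = (\<Sum>c<N. \<Sum>a<N. if a = (i + (N - c)) mod N then of_nat N * complex_of_real (xs ! a * ys ! c) else 0)"
    proof (intro sum.cong refl)
      fix c a assume "c \<in> {..<N}" "a \<in> {..<N}"
      then have ca: "c < N" "a < N" by auto
      have "[a + c = i] (mod N) \<longleftrightarrow> [a + c + (N - c) = i + (N - c)] (mod N)"
        by (simp add: cong_add_rcancel_nat)
      also have "\<dots> \<longleftrightarrow> a = (i + (N - c)) mod N"
        using ca by (simp add: cong_def)
      finally show "(if [a + c = i] (mod N) then of_nat N * complex_of_real (xs ! a * ys ! c) else 0) =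
          (if a = (i + (N - c)) mod N then of_nat N * complex_of_real (xs ! a * ys ! c) else 0)"
        by simp
    qed
    also have "\<dots> = ?rhs"
      using \<open>N > 0\<close> by (simp add: sum.delta sum_distrib_left)
    finally show ?thesis .
  qed
  have w': "inverse w ^ N = 1" by (simp add: power_inverse wN)
  have fft: "result (fft_tm p e N v zs) = map (\<lambda>k. \<Sum>i<N. zs ! i * v ^ (i * k)) [0..<N]"
    if "length zs = N" "v ^ N = 1" for v zs
    using result_fft_tm[OF N(1,2) that] .
  define P where "P = map (\<lambda>i. (\<Sum>a<N. complex_of_real (xs ! a) * w ^ (a * i)) *
      (\<Sum>c<N. complex_of_real (ys ! c) * w ^ (c * i))) [0..<N]"
  have "(\<Sum>k<N. P ! k * inverse w ^ (k * i))
      = of_nat N * complex_of_real (\<Sum>j<N. xs ! ((i + (N - j)) mod N) * ys ! j)" for i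
    unfolding conv[symmetric] by (intro sum.cong) (simp_all add: P_def)
  then have "result (fft_tm p e N (inverse w) P) =
      map (\<lambda>i. of_nat N * complex_of_real (\<Sum>j<N. xs ! ((i + (N - j)) mod N) * ys ! j)) [0..<N]"
    using w' by (subst fft) (simp_all add: P_def)
  moreover have "map (\<lambda>i. result (fft_tm p e N w (map complex_of_real xs)) ! i *
      result (fft_tm p e N w (map complex_of_real ys)) ! i) [0..<N] = P"
    using len wN by (simp add: fft P_def)
  ultimately show ?thesis
    using \<open>N > 0\<close> unfolding circulant_mult_tm_def
    by (simp add: comp_def del: of_real_sum flip: w_def)
qed

lemma length_result_circulant_mult_tm [simp]: "length (result (circulant_mult_tm p e N xs ys)) = N"
  by (simp add: circulant_mult_tm_def)

text \<open>22 = 11 + 2 + 9: the linear passes cost 11 per entry, the two single operations are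
  charged as \<open>2 * N\<close>, and each of the three transforms contributes its constant
  3.\<close>

lemma cost_circulant_mult_tm_le:
  assumes "N = r * p ^ e" "p > 0" "r > 0" "length xs = N" "length ys = N"
  shows "cost (circulant_mult_tm p e N xs ys) \<le> N * (22 + 6 * r + (36 + 12 * p) * e)"
proof -
  have "N > 0" using assms by simp
  have fft: "cost (fft_tm p e N w zs) \<le> N * (2 * r + 3 + (12 + 4 * p) * e)" if "length zs = N" for w zs
    using cost_fft_tm_le[of N r p e zs w] assms that by simp
  let ?F = "\<lambda>w zs. cost (fft_tm p e N w zs)"
  define F where "F = N * (2 * r + 3 + (12 + 4 * p) * e)"
  \<comment> \<open>The inputs of the three transforms matter only through their lengths, so they
    are hidden behind names.\<close>
  obtain w1 zs1 w2 zs2 w3 zs3 where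
    "cost (circulant_mult_tm p e N xs ys) = 11 * N + 2 + ?F w1 zs1 + ?F w2 zs2 + ?F w3 zs3"
    "length zs1 = N" "length zs2 = N" "length zs3 = N"
  proof (rule that)
    show "cost (circulant_mult_tm p e N xs ys) = 11 * N + 2 +
      ?F (cis (2 * pi / real N)) (map complex_of_real xs) +
      ?F (cis (2 * pi / real N)) (map complex_of_real ys) +
      ?F (inverse (cis (2 * pi / real N))) (map (\<lambda>i. result (fft_tm p e N (cis (2 * pi / real N)) (map complex_of_real xs)) ! i *
         result (fft_tm p e N (cis (2 * pi / real N)) (map complex_of_real ys)) ! i) [0..<N])"
      using assms unfolding circulant_mult_tm_def
      by (simp add: cost_map_tm_const[where c = 1] cost_map_tm_const[where c = 3] cost_map_tm_const[where c = 2])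
  qed (use assms in auto)
  then have "cost (circulant_mult_tm p e N xs ys) \<le> 11 * N + 2 * N + 3 * F"
    using fft[of zs1 w1] fft[of zs2 w2] fft[of zs3 w3] \<open>N > 0\<close> by (simp add: F_def)
  then show ?thesis by (simp add: F_def algebra_simps)
qed

section \<open>Symmetry of \<open>\<omega>\<close>\<close>

text \<open>The function \<omega> on residues modulo \<open>M\<close>. Integer arguments make the
  passage from \<open>x\<close> to \<open>- x\<close> expressible.\<close>

definition omega_res :: "real \<Rightarrow> nat \<Rightarrow> int \<Rightarrow> real" where
  "omega_res \<alpha> M x = omega \<alpha> (real_of_int (x mod int M) / real M)"

text \<open>Replacing \<open>x\<close> by \<open>1 - x\<close> amounts to replacing \<open>h\<close>
  by \<open>- h\<close> in the series, because \<open>exp\<close> has period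
  \<open>2 * pi * \<i>\<close>. Reindexing an unordered sum along a bijection is valid irrespective
  of convergence.\<close>

lemma omega_one_minus: "omega \<alpha> (1 - x) = omega \<alpha> x"
proof -
  define f where "f = (\<lambda>(x::real) (h::int). exp (2 * of_real pi * \<i> * of_int h * complex_of_real x) /
    complex_of_real (\<bar>of_int h\<bar> powr \<alpha>))"
  have "f (1 - x) h = f x (- h)" for h
  proof -
    have "exp (2 * of_real pi * \<i> * of_int h) = 1"
      using exp_integer_2pi[of "of_int h"] by (simp add: mult_ac)
    then show ?thesis
      by (simp add: f_def right_diff_distrib exp_diff exp_minus field_simps)
  qed
  then have "(\<Sum>\<^sub>\<infinity>h\<in>UNIV - {0}. f (1 - x) h) = (\<Sum>\<^sub>\<infinity>h\<in>UNIV - {0}. f x (- h))"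
    by simp
  also have "\<dots> = (\<Sum>\<^sub>\<infinity>h\<in>UNIV - {0}. f x h)"
    by (rule infsum_reindex_bij_witness[of _ uminus uminus]) auto
  finally show ?thesis by (simp add: omega_def f_def)
qed

text \<open>Equality of residues after identifying \<open>x\<close> with \<open>- x\<close>: the
  relation on which \<open>omega_res\<close> is constant, and for which the power
  \<open>half_order b l\<close> of the generator is 1.\<close>

definition pm_cong :: "int \<Rightarrow> int \<Rightarrow> int \<Rightarrow> bool" where
  "pm_cong M x y \<longleftrightarrow> [x = y] (mod M) \<or> [x = - y] (mod M)"

lemma pm_cong_mult:
  assumes "pm_cong M x y" "pm_cong M u v"
  shows "pm_cong M (x * u) (y * v)"
proof -
  have "[x * u = y * v] (mod M)" if "[x = y] (mod M)" "[u = v] (mod M)"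
    using cong_mult[OF that] .
  moreover have "[x * u = - (y * v)] (mod M)" if "[x = y] (mod M)" "[u = - v] (mod M)"
    using cong_mult[OF that] by simp
  moreover have "[x * u = - (y * v)] (mod M)" if "[x = - y] (mod M)" "[u = v] (mod M)"
    using cong_mult[OF that] by simp
  moreover have "[x * u = y * v] (mod M)" if "[x = - y] (mod M)" "[u = - v] (mod M)"
    using cong_mult[OF that] by simp
  ultimately show ?thesis using assms by (auto simp: pm_cong_def)
qed

lemma pm_cong_refl [simp]: "pm_cong M x x"
  by (simp add: pm_cong_def)

lemma pm_cong_sym: "pm_cong M x y \<Longrightarrow> pm_cong M y x"
  using cong_minus_minus_iff[of x "- y" M] by (auto simp: pm_cong_def cong_def)

lemma pm_cong_power_one:
  assumes "pm_cong M x 1"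
  shows "pm_cong M (x ^ k) 1"
proof (induction k)
  case (Suc k)
  then show ?case using pm_cong_mult[OF assms Suc] by simp
qed simp

lemma omega_res_cong: "[x = y] (mod int M) \<Longrightarrow> omega_res \<alpha> M x = omega_res \<alpha> M y"
  by (simp add: omega_res_def cong_def)

lemma omega_res_uminus:
  assumes "M > 0"
  shows "omega_res \<alpha> M (- x) = omega_res \<alpha> M x"
\<comment> \<open>The residue 0 is its own negative, whereas \<open>1 - x\<close> would lead to the
  argument 1.\<close>
proof (cases "x mod int M = 0")
  case True
  then show ?thesis by (simp add: omega_res_def zmod_zminus1_eq_if)
next
  case False
  then have "real_of_int ((- x) mod int M) / real M = 1 - real_of_int (x mod int M) / real M"
    using assms by (simp add: zmod_zminus1_eq_if field_simps)
  then show ?thesis by (simp add: omega_res_def omega_one_minus)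
qed

lemma omega_res_pm_cong: "M > 0 \<Longrightarrow> pm_cong (int M) x y \<Longrightarrow> omega_res \<alpha> M x = omega_res \<alpha> M y"
  using omega_res_cong[of x y M \<alpha>] omega_res_cong[of x "- y" M \<alpha>] omega_res_uminus[of M \<alpha> y]
  by (auto simp: pm_cong_def)

text \<open>A column with index divisible by \<open>d\<close> sees the row only modulo the smaller
  modulus. With \<open>d = b ^ (n - l)\<close> this moves the block for \<open>l\<close> to level
  \<open>b ^ l\<close>.\<close>

lemma omega_res_scale:
  assumes "d > 0" "M > 0"
  shows "omega_res \<alpha> (d * M) (int d * x) = omega_res \<alpha> M x"
  using assms by (simp add: omega_res_def mult_mod_right[symmetric])

lemma omega_res_nat: "omega_res \<alpha> M (int x) = omega \<alpha> (real (x mod M) / real M)"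
proof -
  have "real_of_int (int x mod int M) = real (x mod M)"
    by (metis of_int_of_nat_eq zmod_int)
  then show ?thesis by (simp only: omega_res_def)
qed

section \<open>Units modulo prime powers\<close>

lemma prime_eq_2_or_odd: "prime (b::nat) \<Longrightarrow> b = 2 \<or> odd b"
  using prime_odd_nat[of b] prime_gt_1_nat[of b] by fastforce

text \<open>For an odd prime a single element is a primitive root modulo all powers at once, so the
  \<open>LEAST\<close> in \<open>unit_gen\<close> is attained.\<close>

lemma residue_primroot_unit_gen:
  assumes "prime b" "odd b" "l \<ge> 1"
  shows "residue_primroot (b ^ l) (unit_gen b)"
proof -
  obtain g where "\<forall>k>0. residue_primroot (b ^ k) g"
    using residue_primroot_odd_prime_power_exists[OF assms(1,2)] .
  then have "\<forall>l\<ge>1. residue_primroot (b ^ l) g" by auto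
  then have "\<forall>l\<ge>1. residue_primroot (b ^ l) (LEAST g. \<forall>l\<ge>1. residue_primroot (b ^ l) g)"
    by (rule LeastI)
  then show ?thesis using assms by (auto simp: unit_gen_def)
qed

lemma coprime_unit_gen:
  assumes "prime b"
  shows "coprime (unit_gen b) b"
proof (cases "b = 2")
  case True
  then show ?thesis by (simp add: unit_gen_def coprime_right_2_iff_odd)
next
  case False
  then show ?thesis
    using residue_primroot_unit_gen[of b 1] assms prime_eq_2_or_odd[OF assms]
    by (simp add: residue_primroot_def coprime_commute)
qed

lemma coprime_prime_iff: "prime b \<Longrightarrow> coprime u b \<longleftrightarrow> \<not> b dvd (u::nat)"
  by (metis coprime_common_divisor coprime_commute dvd_refl not_prime_unit prime_imp_coprime)

lemma half_order_pos: "prime b \<Longrightarrow> half_order b l > 0"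
  using prime_ge_2_nat[of b] by (auto simp: half_order_def)

lemma half_order_le:
  assumes "prime b" "l \<ge> 1"
  shows "half_order b l \<le> b ^ l"
proof -
  have "(b - 1) div 2 \<le> b" by linarith
  then have "(if b = 2 then 1 else (b - 1) div 2) \<le> b" by simp
  moreover have "b ^ radix_exp b l \<le> b ^ (l - 1)"
    using prime_gt_0_nat[OF assms(1)] by (intro power_increasing) (auto simp: radix_exp_def)
  ultimately have "half_order b l \<le> b * b ^ (l - 1)"
    unfolding half_order_def by (intro mult_le_mono)
  then show ?thesis using assms(2) by (simp flip: power_Suc)
qed

text \<open>The quotient by sign halves the unit group, except for modulus 2, where the sign is
  trivial.\<close>

lemma totient_eq_half_order:
  assumes "prime b" "l \<ge> 1" "b ^ l \<noteq> 2"
  shows "totient (b ^ l) = 2 * half_order b l"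
proof (cases "b = 2")
  case True
  with assms have "l \<noteq> 1" by auto
  with assms have "l \<ge> 2" by simp
  then obtain k where "l = k + 2" by (metis le_add_diff_inverse2)
  moreover have "totient (2 ^ l) = 2 ^ (l - 1)"
    using totient_prime_power[of 2 l] assms by simp
  ultimately show ?thesis using True
    by (simp add: half_order_def radix_exp_def)
next
  case False
  then have "odd b" using assms prime_eq_2_or_odd by blast
  then have "2 * ((b - 1) div 2) = b - 1" by simp
  then show ?thesis using False assms
    by (simp add: totient_prime_power half_order_def radix_exp_def)
qed

text \<open>The power \<open>x\<close> is a square root of 1 other than 1. As \<open>b\<close> is
  odd, it cannot divide both \<open>x - 1\<close> and \<open>x + 1\<close>, so the whole of
  \<open>b ^ l\<close> divides one of them, necessarily \<open>x + 1\<close>.\<close>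

lemma unit_gen_power_half_order_odd:
  assumes "prime b" "odd b" "l \<ge> 1"
  shows "[int (unit_gen b) ^ half_order b l = - 1] (mod int (b ^ l))"
proof -
  define x where "x = int (unit_gen b) ^ half_order b l"
  have "b ^ l \<noteq> 2"
  proof
    assume "b ^ l = 2"
    then have "even (b ^ l)" by simp
    then show False using assms by simp
  qed
  have ord: "ord (b ^ l) (unit_gen b) = 2 * half_order b l"
    using residue_primroot_unit_gen[OF assms] totient_eq_half_order[OF assms(1,3) \<open>b ^ l \<noteq> 2\<close>]
    by (simp add: residue_primroot_def)
  have dvd_iff: "int (b ^ l) dvd int (unit_gen b) ^ k - 1 \<longleftrightarrow> 2 * half_order b l dvd k" for k
  proof -
    have "int (b ^ l) dvd int (unit_gen b) ^ k - 1 \<longleftrightarrow> [unit_gen b ^ k = 1] (mod (b ^ l))"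
      by (metis cong_iff_dvd_diff cong_int_iff of_nat_1 of_nat_power)
    also have "\<dots> \<longleftrightarrow> ord (b ^ l) (unit_gen b) dvd k" by (rule ord_divides)
    finally show ?thesis by (simp only: ord)
  qed
  have nd: "\<not> int (b ^ l) dvd x - 1"
    using dvd_iff[of "half_order b l"] half_order_pos[OF assms(1), of l] nat_dvd_not_less by (auto simp: x_def)
  have "int (b ^ l) dvd x ^ 2 - 1"
    using dvd_iff[of "half_order b l * 2"] by (simp add: x_def power_mult mult.commute)
  then have dvd: "int b ^ l dvd (x - 1) * (x + 1)"
    by (simp add: power2_eq_square algebra_simps)
  have pb: "prime (int b)" using assms by simp
  have "\<not> (int b dvd x - 1 \<and> int b dvd x + 1)"
  proof
    assume "int b dvd x - 1 \<and> int b dvd x + 1"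
    then have "int b dvd (x + 1) - (x - 1)" using dvd_diff[of "int b" "x + 1" "x - 1"] by simp
    then have "int b dvd 2" by simp
    then have "b dvd 2" by (metis int_dvd_int_iff of_nat_numeral)
    then show False using assms primes_dvd_imp_eq two_is_prime_nat by blast
  qed
  then have "coprime (int b) (x - 1) \<or> coprime (int b) (x + 1)"
    using prime_imp_coprime[OF pb] by blast
  then consider "coprime (int b ^ l) (x - 1)" | "coprime (int b ^ l) (x + 1)"
    by auto
  then have "int b ^ l dvd x + 1"
    using dvd nd by cases (auto simp: coprime_dvd_mult_right_iff coprime_dvd_mult_left_iff)
  then show ?thesis by (simp add: cong_iff_dvd_diff x_def)
qed

text \<open>The sign is -1 for odd \<open>b\<close> and +1 for \<open>b = 2\<close>, where 5 has
  order \<open>2 ^ (l - 2)\<close> once \<open>l >= 3\<close>. For the moduli 2 and 4 truncation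
  makes the exponent 1, and 5 is already congruent to 1.\<close>

lemma pm_cong_unit_gen_power_half_order:
  assumes "prime b" "l \<ge> 1"
  shows "pm_cong (int (b ^ l)) (int (unit_gen b) ^ half_order b l) 1"
proof (cases "b = 2")
  case False
  then show ?thesis
    using unit_gen_power_half_order_odd[of b l] prime_eq_2_or_odd assms by (auto simp: pm_cong_def)
next
  case True
  consider "l = 1" | "l = 2" | "l \<ge> 3" using assms by linarith
  then show ?thesis
  proof cases
    case 3
    then have "[5 ^ (2 ^ (l - 2)) = 1::nat] (mod (2 ^ l))"
      using ord_divides[of 5 "2 ^ (l - 2)" "2 ^ l"] ord_twopow_3_5[of l 5] by simp
    then have "[int (5 ^ (2 ^ (l - 2))) = int 1] (mod int (2 ^ l))"
      by (subst cong_int_iff)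
    then show ?thesis using True by (simp add: pm_cong_def unit_gen_def half_order_def radix_exp_def)
  qed (use True in \<open>simp_all add: pm_cong_def unit_gen_def half_order_def radix_exp_def cong_def\<close>)
qed

text \<open>Multiples of \<open>half_order b l\<close> in the exponent contribute only a sign. The
  circulant structure of the blocks, and their repetition along the rows, rest on this.\<close>

lemma pm_cong_unit_gen_power_mod:
  assumes "prime b" "l \<ge> 1"
  shows "pm_cong (int (b ^ l)) (int (unit_gen b) ^ (i mod half_order b l)) (int (unit_gen b) ^ i)"
proof -
  let ?g = "int (unit_gen b)" and ?r = "half_order b l"
  have "pm_cong (int (b ^ l)) ((?g ^ ?r) ^ (i div ?r)) 1"
    by (intro pm_cong_power_one pm_cong_unit_gen_power_half_order assms)
  then have "pm_cong (int (b ^ l)) ((?g ^ ?r) ^ (i div ?r) * ?g ^ (i mod ?r)) (1 * ?g ^ (i mod ?r))"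
    by (intro pm_cong_mult) auto
  moreover have "(?g ^ ?r) ^ (i div ?r) * ?g ^ (i mod ?r) = ?g ^ i"
    by (simp flip: power_mult power_add)
  ultimately show ?thesis by (simp add: pm_cong_sym)
qed

section \<open>Enumeration of the units by signed powers of the generator\<close>

definition units_mod :: "nat \<Rightarrow> nat \<Rightarrow> nat set" where
  "units_mod b l = {u. u < b ^ l \<and> coprime u b}"

definition unit_pow :: "nat \<Rightarrow> nat \<Rightarrow> nat \<Rightarrow> nat" where
  "unit_pow b l i = unit_gen b ^ i mod b ^ l"

lemma units_mod_eq_totatives:
  assumes "prime b" "l \<ge> 1"
  shows "units_mod b l = totatives (b ^ l)"
proof -
  have b: "b > 1" "b ^ l > 1" using assms prime_gt_1_nat[of b] one_less_power[of b l] by auto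
  have "k \<noteq> b ^ l" if "coprime k (b ^ l)" for k
    using that b by auto
  moreover have "k \<noteq> 0" if "coprime k b" for k
    using that b by (intro notI) auto
  moreover have "coprime k (b ^ l) \<longleftrightarrow> coprime k b" for k
    using assms by simp
  ultimately show ?thesis
    unfolding units_mod_def totatives_def by (auto simp: le_less)
qed

lemma unit_pow_in_units_mod:
  assumes "prime b" "l \<ge> 1"
  shows "unit_pow b l i \<in> units_mod b l"
proof -
  have "coprime (unit_gen b ^ i mod b ^ l) (b ^ l)"
    using coprime_unit_gen[OF assms(1)] prime_gt_0_nat[OF assms(1)]
    by (subst coprime_mod_left_iff) simp_all
  then show ?thesis
    using assms prime_gt_0_nat[OF assms(1)] by (simp add: units_mod_def unit_pow_def)
qed

lemma uminus_in_units_mod: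
  assumes "prime b" "l \<ge> 1" "u \<in> units_mod b l"
  shows "b ^ l - u \<in> units_mod b l"
proof -
  have u: "u < b ^ l" "\<not> b dvd u"
    using assms coprime_prime_iff[of b u] by (auto simp: units_mod_def)
  then have "u \<noteq> 0" by (intro notI) simp
  moreover have "\<not> b dvd b ^ l - u"
    using u assms dvd_diffD1[of b "b ^ l" u] dvd_power[of l b] by auto
  ultimately show ?thesis
    using u assms coprime_prime_iff[of b "b ^ l - u"] by (simp add: units_mod_def)
qed

text \<open>The exponents stay below the order of the generator, which is
  \<open>half_order b l\<close> for powers of 2 from 8 on and twice that for odd \<open>b\<close>.
  Modulo 4 there is only one exponent.\<close>

lemma inj_on_unit_pow:
  assumes "prime b" "l \<ge> 1" "b ^ l \<noteq> 2"
  shows "inj_on (unit_pow b l) {..<half_order b l}"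
proof (cases "b = 2 \<and> l \<le> 2")
  case True
  then have "half_order b l = 1" using assms by (auto simp: half_order_def radix_exp_def)
  then show ?thesis by (simp add: inj_on_def)
next
  case False
  have "half_order b l \<le> ord (b ^ l) (unit_gen b)"
  proof (cases "b = 2")
    case True
    then show ?thesis using False ord_twopow_3_5[of l 5]
      by (simp add: unit_gen_def half_order_def radix_exp_def)
  next
    case False
    then have "odd b" using prime_eq_2_or_odd[OF assms(1)] by simp
    then show ?thesis
      using residue_primroot_unit_gen[of b l] totient_eq_half_order[of b l] assms
      by (simp add: residue_primroot_def)
  qed
  moreover have "inj_on (unit_pow b l) {..<ord (b ^ l) (unit_gen b)}"
    unfolding unit_pow_def using coprime_unit_gen[OF assms(1)]
    by (intro inj_power_mod) (simp add: coprime_commute)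
  ultimately show ?thesis by (meson inj_on_subset lessThan_subset_iff)
qed

text \<open>For \<open>b = 2\<close> all powers of 5 are 1 modulo 4, so a sum of two is not
  divisible by 4. For odd \<open>b\<close> a vanishing sum would give
  \<open>g ^ i = g ^ (r + j)\<close> with \<open>r = half_order b l\<close>; both exponents lie
  below the order \<open>2 * r\<close>, which forces \<open>i = r + j\<close>, against
  \<open>i < r\<close>.\<close>

lemma unit_pow_add_neq:
  assumes "prime b" "l \<ge> 1" "b ^ l \<noteq> 2" "i < half_order b l" "j < half_order b l"
  shows "unit_pow b l i + unit_pow b l j \<noteq> b ^ l"
proof
  assume eq: "unit_pow b l i + unit_pow b l j = b ^ l"
  then have "(unit_gen b ^ i + unit_gen b ^ j) mod b ^ l = 0"
    using mod_add_eq[of "unit_gen b ^ i" "b ^ l" "unit_gen b ^ j"] by (simp add: unit_pow_def)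
  then have dvd: "b ^ l dvd unit_gen b ^ i + unit_gen b ^ j" by auto
  show False
  proof (cases "b = 2")
    case True
    with assms have "l \<noteq> 1" by auto
    with assms have "l \<ge> 2" by simp
    then have "2 ^ 2 dvd (2 ^ l :: nat)" by (rule le_imp_power_dvd)
    moreover have "2 ^ l dvd 5 ^ i + (5 ^ j :: nat)" using dvd True by (simp add: unit_gen_def)
    ultimately have "2 ^ 2 dvd 5 ^ i + (5 ^ j :: nat)" by (rule dvd_trans)
    moreover have "[5 ^ i + 5 ^ j = 1 ^ i + 1 ^ j] (mod (4 :: nat))"
      by (intro cong_add cong_pow) (simp_all add: cong_def)
    ultimately show False by (simp add: cong_def dvd_eq_mod_eq_0)
  next
    case False
    then have "odd b" using assms prime_eq_2_or_odd by blast
    let ?g = "int (unit_gen b)" and ?r = "half_order b l"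
    have "int (b ^ l) dvd int (unit_gen b ^ i + unit_gen b ^ j)"
      using dvd by (simp only: int_dvd_int_iff)
    then have "[?g ^ i = - (?g ^ j)] (mod int (b ^ l))"
      by (simp add: cong_iff_dvd_diff)
    moreover have "[?g ^ (?r + j) = - 1 * ?g ^ j] (mod int (b ^ l))"
      unfolding power_add
      by (intro cong_mult unit_gen_power_half_order_odd cong_refl assms \<open>odd b\<close>)
    ultimately have "[?g ^ i = ?g ^ (?r + j)] (mod int (b ^ l))"
      by (simp add: cong_def)
    then have "[unit_gen b ^ i = unit_gen b ^ (?r + j)] (mod b ^ l)"
      by (simp only: cong_int_iff flip: of_nat_power)
    moreover have "inj_on (\<lambda>k. unit_gen b ^ k mod b ^ l) {..<ord (b ^ l) (unit_gen b)}"
      using coprime_unit_gen[OF assms(1)]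
      by (intro inj_power_mod) (simp add: coprime_commute)
    moreover have "ord (b ^ l) (unit_gen b) = 2 * ?r"
      using residue_primroot_unit_gen[of b l] totient_eq_half_order[of b l] assms \<open>odd b\<close>
      by (simp add: residue_primroot_def)
    ultimately have "i = ?r + j"
      using assms by (auto simp: inj_on_def cong_def)
    then show False using assms by simp
  qed
qed

text \<open>Disjointness and injectivity give \<open>2 * half_order b l\<close> distinct units; this
  equals \<open>totient (b ^ l)\<close>, so none is missed.\<close>

lemma unit_pow_images:
  assumes "prime b" "l \<ge> 1" "b ^ l \<noteq> 2"
  defines "A \<equiv> unit_pow b l ` {..<half_order b l}"
  shows "A \<inter> (\<lambda>u. b ^ l - u) ` A = {}" "units_mod b l = A \<union> (\<lambda>u. b ^ l - u) ` A"
    "inj_on (\<lambda>u. b ^ l - u) A"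
proof -
  let ?B = "(\<lambda>u. b ^ l - u) ` A"
  have A: "A \<subseteq> units_mod b l" using assms unit_pow_in_units_mod by auto
  then have lt: "u < b ^ l" if "u \<in> A" for u using that by (auto simp: units_mod_def)
  show disj: "A \<inter> ?B = {}"
  proof (rule ccontr)
    assume "A \<inter> ?B \<noteq> {}"
    then obtain u v where "u \<in> A" "v \<in> A" "u = b ^ l - v" by auto
    then have "u + v = b ^ l" using lt[of v] by simp
    then show False using \<open>u \<in> A\<close> \<open>v \<in> A\<close> unit_pow_add_neq[OF assms(1-3)] by (auto simp: A_def)
  qed
  show inj: "inj_on (\<lambda>u. b ^ l - u) A"
  proof (rule inj_onI)
    fix u v assume "u \<in> A" "v \<in> A" "b ^ l - u = b ^ l - v"
    then show "u = v" using lt[of u] lt[of v] by linarith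
  qed
  have fin: "finite (units_mod b l)" by (simp add: units_mod_def)
  have "card (A \<union> ?B) = card A + card A"
    using disj inj finite_subset[OF A fin] by (simp add: card_Un_disjoint card_image)
  also have "card A = half_order b l"
    unfolding A_def using inj_on_unit_pow[OF assms(1-3)] by (simp add: card_image)
  finally have "card (A \<union> ?B) = card (units_mod b l)"
    using totient_eq_half_order[OF assms(1-3)] units_mod_eq_totatives[OF assms(1,2)] by (simp add: totient_def)
  moreover have "A \<union> ?B \<subseteq> units_mod b l"
    using A uminus_in_units_mod[OF assms(1,2)] by auto
  ultimately show "units_mod b l = A \<union> ?B"
    using fin card_subset_eq by metis
qed

lemma units_mod_2: "units_mod 2 (Suc 0) = {1}"
proof -
  have "u \<in> units_mod 2 (Suc 0) \<longleftrightarrow> u = 1" for u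
    unfolding units_mod_def by (cases "u = 0"; cases "u = 1") auto
  then show ?thesis by blast
qed

lemma power_eq_2_iff:
  assumes "prime (b::nat)"
  shows "b ^ l = 2 \<longleftrightarrow> b = 2 \<and> l = 1"
proof
  assume eq: "b ^ l = 2"
  then have "l \<noteq> 0" by (intro notI) simp
  with eq have "b dvd 2" by (metis dvd_power gr0I)
  then have "b = 2" using assms primes_dvd_imp_eq two_is_prime_nat by blast
  then show "b = 2 \<and> l = 1" using eq power_inject_exp[of "2::nat" l 1] by auto
qed simp

text \<open>Modulo 2 the unit 1 is its own negative and must be counted once; the conditional
  mirrors the one in \<open>block_tm\<close>.\<close>

lemma sum_units_mod:
  assumes "prime b" "l \<ge> 1"
  shows "(\<Sum>u\<in>units_mod b l. f u) =
    (\<Sum>i<half_order b l. f (unit_pow b l i) + (if b ^ l = 2 then 0 else f (b ^ l - unit_pow b l i)))"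
    (is "_ = ?rhs")
proof (cases "b ^ l = 2")
  case True
  then have *: "b = 2" "l = 1" using power_eq_2_iff[OF assms(1)] by auto
  show ?thesis by (simp add: * units_mod_2 half_order_def radix_exp_def unit_pow_def)
next
  case False
  let ?A = "unit_pow b l ` {..<half_order b l}"
  note im = unit_pow_images[OF assms False]
  have "(\<Sum>u\<in>units_mod b l. f u) = (\<Sum>u\<in>?A. f u) + (\<Sum>u\<in>?A. f (b ^ l - u))"
    unfolding im(2) by (subst sum.union_disjoint) (use im in \<open>simp_all add: sum.reindex\<close>)
  then show ?thesis
    using False inj_on_unit_pow[OF assms False] by (simp add: sum.reindex sum.distrib)
qed

lemma units_mod_eq:
  assumes "prime b" "l \<ge> 1"
  shows "units_mod b l = unit_pow b l ` {..<half_order b l} \<union> (\<lambda>u. b ^ l - u) ` unit_pow b l ` {..<half_order b l}"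
proof (cases "b ^ l = 2")
  case True
  then have *: "b = 2" "l = 1" using power_eq_2_iff[OF assms(1)] by auto
  have "{..<Suc 0} = {0}" by auto
  then show ?thesis by (simp add: * units_mod_2 half_order_def radix_exp_def unit_pow_def)
next
  case False
  then show ?thesis by (rule unit_pow_images(2)[OF assms])
qed

text \<open>Induction on \<open>n\<close>: the indices prime to \<open>b\<close> are split off, and
  the multiples of \<open>b\<close>, divided by \<open>b\<close>, fall under the hypothesis. Index 0
  has no valuation and stays as a term of its own.\<close>

lemma sum_by_valuation:
  fixes F :: "nat \<Rightarrow> 'a::comm_monoid_add"
  assumes "prime b"
  shows "(\<Sum>k<b ^ n. F k) = F 0 + (\<Sum>l=1..n. \<Sum>u\<in>units_mod b l. F (b ^ (n - l) * u))"
proof (induction n arbitrary: F)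
  case (Suc n)
  have b: "b > 0" using assms prime_gt_0_nat by blast
  have split: "{..<b ^ Suc n} = units_mod b (Suc n) \<union> (\<lambda>k. b * k) ` {..<b ^ n}"
  proof (rule Set.set_eqI)
    fix k
    have "coprime k b \<longleftrightarrow> \<not> b dvd k" by (rule coprime_prime_iff[OF assms])
    moreover have "b dvd k \<and> k < b ^ Suc n \<longleftrightarrow> k \<in> (\<lambda>k. b * k) ` {..<b ^ n}"
      using b by (auto simp: dvd_def)
    ultimately show "k \<in> {..<b ^ Suc n} \<longleftrightarrow> k \<in> units_mod b (Suc n) \<union> (\<lambda>k. b * k) ` {..<b ^ n}"
      by (auto simp: units_mod_def)
  qed
  have disj: "units_mod b (Suc n) \<inter> (\<lambda>k. b * k) ` {..<b ^ n} = {}"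
    using assms by (auto simp: units_mod_def)
  have "(\<Sum>k<b ^ Suc n. F k) = (\<Sum>u\<in>units_mod b (Suc n). F u) + (\<Sum>k<b ^ n. F (b * k))"
    unfolding split using disj b
    by (subst sum.union_disjoint) (auto simp: units_mod_def sum.reindex inj_on_def)
  also have "(\<Sum>k<b ^ n. F (b * k)) = F 0 + (\<Sum>l=1..n. \<Sum>u\<in>units_mod b l. F (b ^ (Suc n - l) * u))"
    by (subst Suc.IH) (auto intro!: sum.cong simp: Suc_diff_le mult.assoc)
  finally show ?case by (simp add: add_ac)
qed simp

section \<open>Multiplication with \<open>\<Omega>\<close>\<close>

lemma result_half_order_tm [simp]:
  assumes "\<And>i. i \<le> l \<Longrightarrow> bp ! i = b ^ i"
  shows "result (half_order_tm b bp l) = half_order b l"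
  using assms[of "radix_exp b l"] by (simp add: half_order_tm_def half_order_def radix_exp_def)

lemma cost_half_order_tm [simp]: "cost (half_order_tm b bp l) = 3"
  by (simp add: half_order_tm_def)

lemma result_units_tm:
  assumes "\<And>i. i \<le> l \<Longrightarrow> bp ! i = b ^ i" "b > 1" "l \<ge> 1"
  shows "result (units_tm b bp l) = map (unit_pow b l) [0..<half_order b l]"
proof -
  \<comment> \<open>The iteration starts with an unreduced 1, which agrees with
    \<open>unit_pow b l 0\<close> because the modulus exceeds 1.\<close>
  have "1 < b ^ l" using assms one_less_power[of b l] by simp
  then have "((\<lambda>v. v * unit_gen b mod b ^ l) ^^ i) 1 = unit_pow b l i" for i
    by (induction i) (use assms in \<open>auto simp: unit_pow_def mod_simps mult.commute\<close>)
  then show ?thesis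
    using assms by (intro nth_equalityI) (auto simp: units_tm_def nth_result_iter_tm)
qed

lemma cost_units_tm:
  assumes "\<And>i. i \<le> l \<Longrightarrow> bp ! i = b ^ i"
  shows "cost (units_tm b bp l) = 4 + 3 * half_order b l"
  using assms by (simp add: units_tm_def cost_iter_tm_const[where c = 2])

text \<open>With columns listed as \<open>g ^ (- j)\<close>, the argument of \<omega> in row
  \<open>i\<close> and column \<open>j\<close> is \<open>g ^ (i - j)\<close> up to sign, so one
  cyclic convolution evaluates the block. Undoing the column order and the merging of
  \<open>u\<close> with \<open>- u\<close> then yields the plain sum over units.\<close>

lemma result_block_tm:
  assumes b: "prime b" and l: "1 \<le> l" "l \<le> n" "n \<le> m"
    and bp: "\<And>i. i \<le> m \<Longrightarrow> bp ! i = b ^ i"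
    and tab: "\<And>k. k < b ^ m \<Longrightarrow> tab ! k = omega \<alpha> (real k / real (b ^ m))"
  shows "\<exists>C. result (block_tm b bp m n tab q l) = (half_order b l, C) \<and>
    (\<forall>i<half_order b l. C ! i = (\<Sum>u\<in>units_mod b l.
      omega_res \<alpha> (b ^ l) (int (unit_gen b) ^ i * int u) * q ! (b ^ (n - l) * u)))"
proof -
  define r where "r = half_order b l"
  let ?g = "int (unit_gen b)" and ?M = "b ^ l"
  let ?G = "\<lambda>x. omega_res \<alpha> ?M x"
  have b1: "b > 1" and "b > 0" using b prime_gt_1_nat prime_gt_0_nat by auto
  have "r > 0" unfolding r_def by (rule half_order_pos[OF b])
  have M0: "?M > 0" using \<open>b > 0\<close> by simp
  have us: "result (units_tm b bp l) = map (unit_pow b l) [0..<r]"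
    using result_units_tm[of l bp b] bp l b1 by (simp add: r_def)
  have lt: "unit_pow b l i < ?M" for i
    using unit_pow_in_units_mod[OF b l(1)] by (simp add: units_mod_def)
  define as where "as = map (\<lambda>u. tab ! (u * b ^ (m - l))) (map (unit_pow b l) [0..<r])"
  define p where "p = (\<lambda>u. q ! (u * b ^ (n - l)) + (if ?M = 2 then 0 else q ! ((?M - u) * b ^ (n - l))))"
  define ps where "ps = map (\<lambda>j. p (unit_pow b l ((r - j) mod r))) [0..<r]"
  \<comment> \<open>\<open>u / b ^ l\<close> equals \<open>u * b ^ (m - l) / b ^ m\<close>, so the
    one table with denominator \<open>b ^ m\<close> serves the blocks of every level.\<close>
  have tab_unit: "tab ! (u * b ^ (m - l)) = ?G (int u)" if "u < ?M" for u
  proof -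
    have m: "b ^ m = b ^ (m - l) * ?M" using l by (simp flip: power_add)
    have "u * b ^ (m - l) < b ^ m"
      using that \<open>b > 0\<close> unfolding m by simp
    then have "tab ! (u * b ^ (m - l)) = omega \<alpha> (real (u * b ^ (m - l)) / real (b ^ m))"
      by (rule tab)
    also have "real (u * b ^ (m - l)) / real (b ^ m) = real u / real ?M"
      using \<open>b > 0\<close> unfolding m by simp
    finally show ?thesis using that by (simp add: omega_res_nat)
  qed
  have upow: "[int (unit_pow b l i) = ?g ^ i] (mod int ?M)" for i
    by (simp add: unit_pow_def cong_def zmod_int)
  have as_nth: "as ! i = ?G (?g ^ i)" if "i < r" for i
    using that tab_unit[OF lt[of i]] omega_res_cong[OF upow] by (simp add: as_def)
  have ps_nth: "ps ! j = p (unit_pow b l ((r - j) mod r))" if "j < r" for j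
    using that by (simp add: ps_def)
  define C where "C = result (circulant_mult_tm b (radix_exp b l) r as ps)"
  have res: "result (block_tm b bp m n tab q l) = (r, C)"
  proof -
    have [simp]: "bp ! l = b ^ l" "bp ! (n - l) = b ^ (n - l)" "bp ! (m - l) = b ^ (m - l)"
      using bp l by auto
    have [simp]: "result (half_order_tm b bp l) = r"
      using bp l by (simp add: r_def)
    define us where "us = map (unit_pow b l) [0..<r]"
    define psm where "psm = map_tm (\<lambda>j. do {
         j1 \<leftarrow> tick (r - j);
         j2 \<leftarrow> tick (j1 mod r);
         u \<leftarrow> read us j2;
         i1 \<leftarrow> tick (u * b ^ (n - l));
         x1 \<leftarrow> read q i1;
         u' \<leftarrow> tick (b ^ l - u);
         i2 \<leftarrow> tick (u' * b ^ (n - l));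
         x2 \<leftarrow> read q i2;
         c \<leftarrow> tick (b ^ l = 2);
         if c then ret x1 else tick (x1 + x2) }) [0..<r]"
    define asm where "asm = map_tm (\<lambda>u. do { i \<leftarrow> tick (u * b ^ (m - l)); read tab i }) us"
    have "result asm = as"
      by (simp add: asm_def as_def us_def)
    moreover have "result psm = ps"
      using \<open>r > 0\<close> by (auto simp: psm_def ps_def p_def us_def)
    moreover have "result (block_tm b bp m n tab q l) =
        (r, result (circulant_mult_tm b (radix_exp b l) r (result asm) (result psm)))"
      unfolding block_tm_def psm_def asm_def us_def using us by simp
    ultimately show ?thesis unfolding C_def by simp
  qed
  have "C ! i = (\<Sum>u\<in>units_mod b l. ?G (?g ^ i * int u) * q ! (b ^ (n - l) * u))" if "i < r" for i
  proof -
    have "r = (if b = 2 then 1 else (b - 1) div 2) * b ^ radix_exp b l"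
      by (simp add: r_def half_order_def)
    then have "C ! i = (\<Sum>j<r. as ! ((i + (r - j)) mod r) * ps ! j)"
      unfolding C_def
      using result_circulant_mult_tm[of r _ b "radix_exp b l" as ps] that \<open>b > 0\<close> \<open>r > 0\<close>
      by (simp add: as_def ps_def)
    also have "\<dots> = (\<Sum>j<r. ?G (?g ^ i * ?g ^ ((r - j) mod r)) * p (unit_pow b l ((r - j) mod r)))"
    proof (intro sum.cong refl)
      fix j assume "j \<in> {..<r}"
      have "as ! ((i + (r - j)) mod r) = ?G (?g ^ ((i + (r - j) mod r) mod r))"
        using \<open>r > 0\<close> by (simp add: as_nth mod_simps)
      also have "\<dots> = ?G (?g ^ (i + (r - j) mod r))"
        unfolding r_def by (intro omega_res_pm_cong pm_cong_unit_gen_power_mod M0 b l)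
      finally show "as ! ((i + (r - j)) mod r) * ps ! j
          = ?G (?g ^ i * ?g ^ ((r - j) mod r)) * p (unit_pow b l ((r - j) mod r))"
        using \<open>j \<in> {..<r}\<close> by (simp add: ps_nth power_add)
    qed
    \<comment> \<open>The map from \<open>j\<close> to \<open>(r - j) mod r\<close> is an involution
      of the exponents; it undoes the reversed listing of the columns.\<close>
    also have "\<dots> = (\<Sum>j<r. ?G (?g ^ i * ?g ^ j) * p (unit_pow b l j))"
    proof (rule sum.reindex_bij_witness[of _ "\<lambda>j. (r - j) mod r" "\<lambda>j. (r - j) mod r"])
      fix j assume "j \<in> {..<r}"
      then show "(r - (r - j) mod r) mod r = j" by (cases "j = 0") auto
      then show "(r - (r - j) mod r) mod r = j" .
    qed (use \<open>r > 0\<close> in auto)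
    also have "\<dots> = (\<Sum>j<r. ?G (?g ^ i * int (unit_pow b l j)) * q ! (b ^ (n - l) * unit_pow b l j) +
        (if ?M = 2 then 0 else ?G (?g ^ i * int (?M - unit_pow b l j)) * q ! (b ^ (n - l) * (?M - unit_pow b l j))))"
    proof (intro sum.cong refl)
      fix j assume "j \<in> {..<r}"
      have 1: "?G (?g ^ i * int (unit_pow b l j)) = ?G (?g ^ i * ?g ^ j)"
        by (intro omega_res_cong cong_mult upow cong_refl)
      \<comment> \<open>By evenness the column of \<open>- u\<close> carries the same value of
        \<omega>, so the merged weight can be split again.\<close>
      have "[int ?M + - int (unit_pow b l j) = 0 + - (?g ^ j)] (mod int ?M)"
        using upow[of j] by (intro cong_add) (simp_all add: cong_minus_minus_iff cong_0_iff)
      then have "[?g ^ i * int (?M - unit_pow b l j) = ?g ^ i * - (?g ^ j)] (mod int ?M)"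
        using lt[of j] by (intro cong_mult cong_refl) (simp add: of_nat_diff)
      then have 2: "?G (?g ^ i * int (?M - unit_pow b l j)) = ?G (?g ^ i * ?g ^ j)"
        using omega_res_cong omega_res_uminus[OF M0] by simp
      show "?G (?g ^ i * ?g ^ j) * p (unit_pow b l j) =
          ?G (?g ^ i * int (unit_pow b l j)) * q ! (b ^ (n - l) * unit_pow b l j) +
        (if ?M = 2 then 0 else ?G (?g ^ i * int (?M - unit_pow b l j)) * q ! (b ^ (n - l) * (?M - unit_pow b l j)))"
        unfolding 1 2 by (simp add: p_def algebra_simps)
    qed
    also have "\<dots> = (\<Sum>u\<in>units_mod b l. ?G (?g ^ i * int u) * q ! (b ^ (n - l) * u))"
      unfolding r_def by (rule sum_units_mod[OF b l(1), symmetric])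
    finally show ?thesis .
  qed
  with res show ?thesis unfolding r_def by blast
qed

text \<open>The transform dominates: it has length \<open>r <= b ^ l\<close> and
  \<open>radix_exp b l <= l\<close> levels. The linear passes are absorbed through
  \<open>r > 0\<close> and \<open>l >= 1\<close>, with constants rounded up.\<close>

lemma cost_block_tm_le:
  assumes b: "prime b" and l: "1 \<le> l" "l \<le> n" "n \<le> m"
    and bp: "\<And>i. i \<le> m \<Longrightarrow> bp ! i = b ^ i"
  shows "cost (block_tm b bp m n tab q l) \<le> (100 + 20 * b) * (l * b ^ l)"
proof -
  define r where "r = half_order b l"
  have b1: "b > 1" and "b > 0" using b prime_gt_1_nat prime_gt_0_nat by auto
  have "r > 0" unfolding r_def by (rule half_order_pos[OF b])
  have "r \<le> b ^ l" unfolding r_def by (rule half_order_le[OF b l(1)])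
  have [simp]: "bp ! l = b ^ l" "bp ! (n - l) = b ^ (n - l)" "bp ! (m - l) = b ^ (m - l)"
    using bp l by auto
  have [simp]: "result (half_order_tm b bp l) = r"
    using bp l by (simp add: r_def)
  have us: "result (units_tm b bp l) = map (unit_pow b l) [0..<r]" "cost (units_tm b bp l) = 4 + 3 * r"
    using result_units_tm[of l bp b] cost_units_tm[of l bp b] bp l b1 by (simp_all add: r_def)
  define c where "c = (if b = 2 then 1 else (b - 1) div 2)"
  have r: "r = c * b ^ radix_exp b l" by (simp add: r_def half_order_def c_def)
  have "c > 0" using \<open>r > 0\<close> by (simp add: r)
  have "(b - 1) div 2 \<le> b" by linarith
  then have "c \<le> b" using b1 by (simp add: c_def)
  have circ: "cost (circulant_mult_tm b (radix_exp b l) r as ps) \<le> r * (22 + 6 * c + (36 + 12 * b) * radix_exp b l)"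
    if "length as = r" "length ps = r" for as ps
    by (rule cost_circulant_mult_tm_le[OF r \<open>b > 0\<close> \<open>c > 0\<close> that])
  obtain as ps where "length as = r" "length ps = r"
    "cost (block_tm b bp m n tab q l) \<le> 16 + 18 * r + cost (circulant_mult_tm b (radix_exp b l) r as ps)"
  proof -
    define us where "us = map (unit_pow b l) [0..<r]"
    define psm where "psm = map_tm (\<lambda>j. do {
         j1 \<leftarrow> tick (r - j);
         j2 \<leftarrow> tick (j1 mod r);
         u \<leftarrow> read us j2;
         i1 \<leftarrow> tick (u * b ^ (n - l));
         x1 \<leftarrow> read q i1;
         u' \<leftarrow> tick (b ^ l - u);
         i2 \<leftarrow> tick (u' * b ^ (n - l));
         x2 \<leftarrow> read q i2;
         c \<leftarrow> tick (b ^ l = 2);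
         if c then ret x1 else tick (x1 + x2) }) [0..<r]"
    define asm where "asm = map_tm (\<lambda>u. do { i \<leftarrow> tick (u * b ^ (m - l)); read tab i }) us"
    \<comment> \<open>An inequality, since the branch for modulus 2 skips the last addition.\<close>
    have "cost psm \<le> length [0..<r] * (10 + 1)"
      unfolding psm_def by (rule cost_map_tm_le) auto
    moreover have "cost asm = 3 * r"
      unfolding asm_def by (subst cost_map_tm_const[where c = 2]) (auto simp: us_def)
    moreover have "cost (block_tm b bp m n tab q l) = 13 + 3 * r + cost asm + cost psm +
        cost (circulant_mult_tm b (radix_exp b l) r (result asm) (result psm))"
      using us unfolding block_tm_def psm_def asm_def us_def by simp
    moreover have "length (result asm) = r" "length (result psm) = r"
      by (simp_all add: asm_def psm_def us_def)
    ultimately show thesis by (intro that[of "result asm" "result psm"]) auto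
  qed
  then have "cost (block_tm b bp m n tab q l) \<le> 16 + 18 * r + r * (22 + 6 * c + (36 + 12 * b) * radix_exp b l)"
    using circ[of as ps] by linarith
  also have "\<dots> \<le> r * 16 + 18 * r + r * (22 + 6 * b + (36 + 12 * b) * l)"
    using \<open>c \<le> b\<close> \<open>r > 0\<close>
    by (intro add_mono mult_le_mono le_refl) (auto simp: radix_exp_def)
  also have "\<dots> = r * (56 + 6 * b + (36 + 12 * b) * l)" by (simp add: algebra_simps)
  also have "\<dots> \<le> r * ((56 + 6 * b) * l + (36 + 12 * b) * l)"
    using l(1) by (intro mult_le_mono2 add_mono le_refl) auto
  also have "\<dots> \<le> r * ((100 + 20 * b) * l)"
    by (intro mult_le_mono2) (simp flip: distrib_right)
  also have "\<dots> \<le> b ^ l * ((100 + 20 * b) * l)"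
    using \<open>r \<le> b ^ l\<close> by (rule mult_le_mono1)
  finally show ?thesis by (simp add: mult_ac)
qed

lemma fold_plus_eq_sum_list: "fold (\<lambda>x a. a + f x) xs a = a + (\<Sum>x\<leftarrow>xs. f x)"
  for f :: "'a \<Rightarrow> 'b::comm_monoid_add"
  by (induction xs arbitrary: a) (simp_all add: add_ac)

text \<open>Bounding the factor \<open>l\<close> by \<open>n\<close> first leaves a geometric sum,
  at most twice \<open>b ^ n\<close>. Summing over all blocks thus costs a constant factor and not a
  further factor \<open>n\<close>.\<close>

lemma sum_upt_mult_pow_le:
  fixes b :: nat
  assumes "b \<ge> 2"
  shows "(\<Sum>l\<leftarrow>[1..<Suc n]. K * (l * b ^ l) + 1) \<le> (2 * K + 1) * (n * b ^ n)"
proof -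
  have geo: "(\<Sum>l=1..n. b ^ l) \<le> 2 * b ^ n" for n
  proof (induction n)
    case (Suc n)
    have "(\<Sum>l=1..Suc n. b ^ l) \<le> 2 * b ^ n + b ^ Suc n" using Suc by simp
    also have "2 * b ^ n \<le> b ^ Suc n" using assms by simp
    finally show ?case by simp
  qed simp
  have "(\<Sum>l\<leftarrow>[1..<Suc n]. K * (l * b ^ l) + 1) = (\<Sum>l=1..n. K * (l * b ^ l) + 1)"
    by (simp add: interv_sum_list_conv_sum_set_nat atLeastLessThanSuc_atLeastAtMost del: upt_Suc)
  also have "\<dots> \<le> (\<Sum>l=1..n. K * n * b ^ l + 1)"
    by (intro sum_mono add_mono) auto
  also have "\<dots> = K * n * (\<Sum>l=1..n. b ^ l) + n"
    by (simp add: sum_distrib_left sum.distrib del: Suc_eq_plus1 add_Suc_right)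
  also have "\<dots> \<le> K * n * (2 * b ^ n) + n * b ^ n"
    using geo[of n] assms by (intro add_mono mult_le_mono2) auto
  finally show ?thesis by (simp add: algebra_simps)
qed

section \<open>Rows of \<Omega> and their decomposition into blocks\<close>

definition omega_row :: "real \<Rightarrow> nat \<Rightarrow> nat \<Rightarrow> real list \<Rightarrow> nat \<Rightarrow> real" where
  "omega_row \<alpha> b n q z = (\<Sum>k<b ^ n. omega_res \<alpha> (b ^ n) (int k * int z) * q ! k)"

lemma omega_row_uminus:
  assumes "b > 0" "u \<le> b ^ n"
  shows "omega_row \<alpha> b n q (b ^ n - u) = omega_row \<alpha> b n q u"
proof -
  have "omega_res \<alpha> (b ^ n) (int k * int (b ^ n - u)) = omega_res \<alpha> (b ^ n) (int k * int u)" for k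
  proof -
    have "int k * int (b ^ n - u) = int k * int (b ^ n) + - (int k * int u)"
      using assms by (simp add: of_nat_diff algebra_simps)
    moreover have "[int k * int (b ^ n) + - (int k * int u) = 0 + - (int k * int u)] (mod int (b ^ n))"
      by (intro cong_add cong_refl) (simp add: cong_0_iff)
    ultimately have "[int k * int (b ^ n - u) = - (int k * int u)] (mod int (b ^ n))"
      by simp
    then show ?thesis
      using omega_res_cong omega_res_uminus[of "b ^ n"] assms by simp
  qed
  then show ?thesis by (simp add: omega_row_def)
qed

text \<open>The columns are sorted by valuation. The block for \<open>l\<close> depends on
  \<open>z\<close> only modulo \<open>b ^ l\<close>, which is why a block of order
  \<open>half_order b l\<close> can be reused for all rows.\<close>

lemma omega_row_eq_sum_blocks:
  assumes "prime b"
  shows "omega_row \<alpha> b n q z = omega \<alpha> 0 * q ! 0 +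
    (\<Sum>l=1..n. \<Sum>u\<in>units_mod b l. omega_res \<alpha> (b ^ l) (int z * int u) * q ! (b ^ (n - l) * u))"
proof -
  have "b > 0" using assms prime_gt_0_nat by blast
  have "omega_res \<alpha> (b ^ n) (int (b ^ (n - l) * u) * int z) = omega_res \<alpha> (b ^ l) (int z * int u)"
    if "l \<in> {1..n}" for l u
  proof -
    have "b ^ n = b ^ (n - l) * b ^ l" using that by (simp flip: power_add)
    then show ?thesis
      using omega_res_scale[of "b ^ (n - l)" "b ^ l" \<alpha> "int z * int u"] \<open>b > 0\<close> by (simp add: mult_ac)
  qed
  then show ?thesis
    unfolding omega_row_def by (simp add: sum_by_valuation[OF assms] omega_res_def)
qed

text \<open>The three claims share their local definitions. The first speaks of the set of entries
  because for modulus 2 the list contains the unit 1 twice, which the minimisation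
  tolerates.\<close>

lemma omega_mult_tm:
  assumes b: "prime b" and n: "1 \<le> n" "n \<le> m"
    and bp: "\<And>i. i \<le> m \<Longrightarrow> bp ! i = b ^ i"
  shows set_result_omega_mult_tm:
      "(\<And>k. k < b ^ m \<Longrightarrow> tab ! k = omega \<alpha> (real k / real (b ^ m))) \<Longrightarrow>
       set (result (omega_mult_tm b bp m n tab q)) = (\<lambda>z. (z, omega_row \<alpha> b n q z)) ` units_mod b n"
    and length_result_omega_mult_tm: "length (result (omega_mult_tm b bp m n tab q)) = 2 * half_order b n"
    and cost_omega_mult_tm_le: "cost (omega_mult_tm b bp m n tab q) \<le> (300 + 50 * b) * (n * b ^ n)"
proof -
  have b2: "b \<ge> 2" using b prime_ge_2_nat by blast
  define r where "r = half_order b n"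
  define blocks where "blocks = map_tm (block_tm b bp m n tab q) [1..<Suc n]"
  define us where "us = map (unit_pow b n) [0..<r]"
  define posm where "posm = map_tm (\<lambda>i. do {
         u \<leftarrow> read us i;
         t \<leftarrow> fold_tm (\<lambda>(r', C) a. do {
             i' \<leftarrow> tick (i mod r');
             x \<leftarrow> read C i';
             tick (a + x) }) (result blocks) (tab ! 0 * q ! 0);
         ret (u, t) }) [0..<r]"
  define pos where "pos = result posm"
  define neg where "neg = map (\<lambda>(u, t). (b ^ n - u, t)) pos"
  have us: "result (units_tm b bp n) = us" "cost (units_tm b bp n) = 4 + 3 * r"
    using result_units_tm[of n bp b] cost_units_tm[of n bp b] bp n b2 by (simp_all add: r_def us_def)
  have r: "result (half_order_tm b bp n) = r" using bp n by (simp add: r_def)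
  have bpn: "bp ! n = b ^ n" using bp n by simp
  have len_pos: "length pos = r" by (simp add: pos_def posm_def)
  have res: "result (omega_mult_tm b bp m n tab q) = pos @ neg"
    unfolding omega_mult_tm_def pos_def neg_def posm_def blocks_def
    by (simp add: us r bpn case_prod_beta comp_def del: upt_Suc)
  show "length (result (omega_mult_tm b bp m n tab q)) = 2 * half_order b n"
    by (simp add: res neg_def len_pos r_def)
  have pos: "pos = map (\<lambda>i. (unit_pow b n i, tab ! 0 * q ! 0 +
      (\<Sum>l=1..n. snd (result (block_tm b bp m n tab q l)) ! (i mod fst (result (block_tm b bp m n tab q l)))))) [0..<r]"
    by (simp add: pos_def posm_def us_def blocks_def result_fold_tm case_prod_beta comp_def fold_map
        fold_plus_eq_sum_list interv_sum_list_conv_sum_set_nat atLeastLessThanSuc_atLeastAtMost del: upt_Suc)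
  show "set (result (omega_mult_tm b bp m n tab q)) = (\<lambda>z. (z, omega_row \<alpha> b n q z)) ` units_mod b n"
    if tab: "\<And>k. k < b ^ m \<Longrightarrow> tab ! k = omega \<alpha> (real k / real (b ^ m))"
  proof -
    have "tab ! 0 * q ! 0 +
        (\<Sum>l=1..n. snd (result (block_tm b bp m n tab q l)) ! (i mod fst (result (block_tm b bp m n tab q l))))
        = omega_row \<alpha> b n q (unit_pow b n i)" (is "?lhs = ?rhs") if "i < r" for i
    proof -
      have "snd (result (block_tm b bp m n tab q l)) ! (i mod fst (result (block_tm b bp m n tab q l)))
          = (\<Sum>u\<in>units_mod b l. omega_res \<alpha> (b ^ l) (int (unit_pow b n i) * int u) * q ! (b ^ (n - l) * u))"
        (is "?block = _") if l: "l \<in> {1..n}" for l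
      proof -
        obtain C where C: "result (block_tm b bp m n tab q l) = (half_order b l, C)"
          "\<And>i. i < half_order b l \<Longrightarrow> C ! i = (\<Sum>u\<in>units_mod b l.
            omega_res \<alpha> (b ^ l) (int (unit_gen b) ^ i * int u) * q ! (b ^ (n - l) * u))"
          using result_block_tm[OF b, of l n m bp tab \<alpha> q] l n bp tab by auto
        have "?block = (\<Sum>u\<in>units_mod b l.
            omega_res \<alpha> (b ^ l) (int (unit_gen b) ^ (i mod half_order b l) * int u) * q ! (b ^ (n - l) * u))"
          using C(2)[of "i mod half_order b l"] half_order_pos[OF b, of l] by (simp add: C(1))
        \<comment> \<open>Row \<open>i\<close> reads entry \<open>i mod half_order b l\<close> of
          the block; lifting the reduction changes the argument of \<omega> only by a sign.\<close>
        also have "\<dots> = (\<Sum>u\<in>units_mod b l.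
            omega_res \<alpha> (b ^ l) (int (unit_gen b) ^ i * int u) * q ! (b ^ (n - l) * u))"
          using l b2 b by (intro sum.cong refl arg_cong2[of _ _ _ _ "(*)"] omega_res_pm_cong
              pm_cong_mult pm_cong_unit_gen_power_mod pm_cong_refl) auto
        also have "\<dots> = (\<Sum>u\<in>units_mod b l.
            omega_res \<alpha> (b ^ l) (int (unit_pow b n i) * int u) * q ! (b ^ (n - l) * u))"
        proof (intro sum.cong refl arg_cong2[of _ _ _ _ "(*)"] omega_res_cong cong_mult cong_refl)
          have "[int (unit_pow b n i) = int (unit_gen b) ^ i] (mod int (b ^ n))"
            by (simp add: unit_pow_def cong_def zmod_int)
          moreover have "int (b ^ l) dvd int (b ^ n)"
            using l by (simp add: le_imp_power_dvd)
          ultimately show "[int (unit_gen b) ^ i = int (unit_pow b n i)] (mod int (b ^ l))"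
            using cong_dvd_modulus cong_sym by blast
        qed
        finally show ?thesis .
      qed
      then show ?thesis
        using tab[of 0] b2 by (simp add: omega_row_eq_sum_blocks[OF b])
    qed
    then have pos': "pos = map (\<lambda>i. (unit_pow b n i, omega_row \<alpha> b n q (unit_pow b n i))) [0..<r]"
      unfolding pos by simp
    have "set (pos @ neg) = (\<lambda>z. (z, omega_row \<alpha> b n q z)) ` (unit_pow b n ` {..<r} \<union> (\<lambda>u. b ^ n - u) ` unit_pow b n ` {..<r})"
    proof -
      have "unit_pow b n i < b ^ n" for i
        using unit_pow_in_units_mod[OF b n(1)] by (simp add: units_mod_def)
      then have "omega_row \<alpha> b n q (b ^ n - unit_pow b n i) = omega_row \<alpha> b n q (unit_pow b n i)" for i
        using b2 by (intro omega_row_uminus) (auto intro: less_imp_le)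
      then show ?thesis
        by (simp add: pos' neg_def image_Un image_image atLeast0LessThan)
    qed
    then show ?thesis
      using units_mod_eq[OF b n(1)] by (simp add: res r_def)
  qed
  have "cost blocks \<le> (\<Sum>l\<leftarrow>[1..<Suc n]. (100 + 20 * b) * (l * b ^ l) + 1)"
    unfolding blocks_def cost_map_tm
    using cost_block_tm_le[OF b _ _ n(2) bp] by (intro sum_list_mono add_mono) auto
  also have "\<dots> \<le> (2 * (100 + 20 * b) + 1) * (n * b ^ n)"
    by (rule sum_upt_mult_pow_le[OF b2])
  finally have blocks: "cost blocks \<le> (2 * (100 + 20 * b) + 1) * (n * b ^ n)" .
  have "length (result blocks) = n" by (simp add: blocks_def)
  then have posm: "cost posm = r * (4 * n + 2)"
    unfolding posm_def
    by (subst cost_map_tm_const[where c = "4 * n + 1"])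
       (auto simp: cost_fold_tm_const[where c = 3] case_prod_beta)
  have "cost (omega_mult_tm b bp m n tab q) = 11 + 3 * r + cost blocks + cost posm + 3 * r"
    unfolding omega_mult_tm_def posm_def blocks_def
    by (simp add: us r bpn cost_map_tm_const[where c = 1] case_prod_beta del: upt_Suc)
  also have "\<dots> = 11 + 8 * r + 4 * n * r + cost blocks" by (simp add: posm algebra_simps)
  also have "\<dots> \<le> 11 * (n * b ^ n) + 8 * (n * b ^ n) + 4 * (n * b ^ n) + (2 * (100 + 20 * b) + 1) * (n * b ^ n)"
  proof -
    have "r \<le> b ^ n" unfolding r_def by (rule half_order_le[OF b n(1)])
    moreover have "1 * b ^ n \<le> n * b ^ n" using n by (intro mult_le_mono1)
    moreover have "b ^ n \<ge> 1" using b2 by simp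
    moreover have "n * r \<le> n * b ^ n" using \<open>r \<le> b ^ n\<close> by (rule mult_le_mono2)
    ultimately show ?thesis using blocks by linarith
  qed
  \<comment> \<open>The coefficients add up to \<open>224 + 40 * b\<close>, rounded up here.\<close>
  also have "\<dots> \<le> (300 + 50 * b) * (n * b ^ n)"
    by (simp flip: distrib_right)
  finally show "cost (omega_mult_tm b bp m n tab q) \<le> (300 + 50 * b) * (n * b ^ n)" .
qed

section \<open>The search\<close>

lemma fold_argmin:
  fixes xs :: "(nat \<times> real) list"
  defines "f \<equiv> \<lambda>x y. if snd x < snd y then x else (y :: nat \<times> real)"
  shows "fold f xs y \<in> insert y (set xs) \<and> (\<forall>x\<in>insert y (set xs). snd (fold f xs y) \<le> snd x)"
proof (induction xs arbitrary: y)
  case (Cons x xs)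
  have "snd (f x y) \<le> snd x" "snd (f x y) \<le> snd y" "f x y \<in> {x, y}" by (auto simp: f_def)
  then show ?case using Cons[of "f x y"] by force
qed simp

lemma result_argmin_tm:
  assumes "set xs = (\<lambda>z. (z, T z)) ` Z" "Z \<noteq> {}"
  shows "is_arg_min T (\<lambda>z. z \<in> Z) (result (argmin_tm xs))"
proof -
  define p where "p = fold (\<lambda>x y. if snd x < snd y then x else y) xs (xs ! 0)"
  have "xs \<noteq> []" using assms by auto
  then have "xs ! 0 \<in> set xs" by simp
  then have "p \<in> set xs" "\<forall>x\<in>set xs. snd p \<le> snd x"
    using fold_argmin[of xs "xs ! 0"] unfolding p_def by (auto simp: insert_absorb)
  moreover have "result (argmin_tm xs) = fst p"
    by (simp add: argmin_tm_def result_fold_tm p_def)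
  ultimately show ?thesis using assms
    by (force simp: is_arg_min_def not_less)
qed

lemma cost_argmin_tm [simp]: "cost (argmin_tm xs) = 1 + 2 * length xs"
  by (simp add: argmin_tm_def cost_fold_tm_const[where c = 1])

section \<open>Table lookup, the running product and a single search step\<close>

lemma result_factor_tm [simp]: "result (factor_tm \<gamma> N tab j \<xi> k) = 1 + \<gamma> j * tab ! (k * \<xi> mod N)"
  by (simp add: factor_tm_def)

lemma cost_factor_tm [simp]: "cost (factor_tm \<gamma> N tab j \<xi> k) = 6"
  by (simp add: factor_tm_def)

lemma wce_factor_eq_table:
  assumes "N > 0" "\<And>k. k < N \<Longrightarrow> tab ! k = omega \<alpha> (real k / real N)"
  shows "wce_factor \<alpha> \<gamma> N j \<xi> k = 1 + \<gamma> j * tab ! (k * \<xi> mod N)"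
proof -
  have "frac (real k * real \<xi> / real N) = real (k * \<xi> mod N) / real N"
  proof -
    have "real (k * \<xi>) = real N * real (k * \<xi> div N) + real (k * \<xi> mod N)"
      by (metis mult_div_mod_eq of_nat_add of_nat_mult)
    then have "real k * real \<xi> / real N = real (k * \<xi> mod N) / real N + of_int (int (k * \<xi> div N))"
      using assms(1) by (simp add: field_simps)
    then have "frac (real k * real \<xi> / real N) = frac (real (k * \<xi> mod N) / real N + of_int (int (k * \<xi> div N)))"
      by (rule arg_cong)
    also have "\<dots> = frac (real (k * \<xi> mod N) / real N)" by (rule frac_add_of_int_right)
    finally show ?thesis using assms(1) by (simp add: frac_eq)
  qed
  then show ?thesis using assms by (simp add: wce_factor_def)
qed

lemma wce_factor_cong: "[\<xi> = \<xi>'] (mod N) \<Longrightarrow> N > 0 \<Longrightarrow> wce_factor \<alpha> \<gamma> N j \<xi> k = wce_factor \<alpha> \<gamma> N j \<xi>' k"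
  using wce_factor_eq_table[of N "map (\<lambda>k. omega \<alpha> (real k / real N)) [0..<N]" \<alpha> \<gamma> j _ k]
    cong_scalar_left[of \<xi> \<xi>' N k] by (simp add: cong_def)

text \<open>The content of \<open>q\<close> on entry to iteration \<open>d\<close>: coordinates
  below \<open>d\<close> are already replaced, the others still carry their initial factors. At
  \<open>d = 1\<close> this is the initialisation.\<close>

definition partial_q ::
  "real \<Rightarrow> (nat \<Rightarrow> real) \<Rightarrow> nat \<Rightarrow> nat \<Rightarrow> nat \<Rightarrow> (nat \<Rightarrow> nat) \<Rightarrow> (nat \<Rightarrow> nat) \<Rightarrow> (nat \<Rightarrow> nat)
     \<Rightarrow> nat \<Rightarrow> nat \<Rightarrow> real" where
  "partial_q \<alpha> \<gamma> b m s w z0 z d k =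
     (\<Prod>j=1..<d. wce_factor \<alpha> \<gamma> (b ^ m) j (b ^ w j * z j) k) *
     (\<Prod>j=d..s. wce_factor \<alpha> \<gamma> (b ^ m) j (z0 j) k)"

lemma partial_q_eq_q_omit:
  "d \<le> s \<Longrightarrow> partial_q \<alpha> \<gamma> b m s w z0 z d k =
    q_omit \<alpha> \<gamma> b m s w z0 z d k * wce_factor \<alpha> \<gamma> (b ^ m) d (z0 d) k"
  by (simp add: partial_q_def q_omit_def prod.atLeast_Suc_atMost mult_ac)

lemma q_omit_cong:
  "(\<And>j. 1 \<le> j \<Longrightarrow> j < d \<Longrightarrow> z j = z' j) \<Longrightarrow>
    q_omit \<alpha> \<gamma> b m s w z0 z d = q_omit \<alpha> \<gamma> b m s w z0 z' d"
  by (intro ext) (simp add: q_omit_def)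

lemma partial_q_Suc:
  "1 \<le> d \<Longrightarrow> partial_q \<alpha> \<gamma> b m s w z0 (z(d := x)) (Suc d) k =
    q_omit \<alpha> \<gamma> b m s w z0 z d k * wce_factor \<alpha> \<gamma> (b ^ m) d (b ^ w d * x) k"
  by (simp add: partial_q_def q_omit_def mult_ac)

text \<open>The criterion for coordinate \<open>d\<close> ignores \<open>z\<close> from
  \<open>d\<close> on. Minimality found during the search therefore survives later updates and can
  be stated for the final vector, as \<open>scs_outcome\<close> does.\<close>

lemma T_val_cong:
  "(\<And>j. 1 \<le> j \<Longrightarrow> j < d \<Longrightarrow> z j = z' j) \<Longrightarrow>
    T_val \<alpha> \<gamma> b m s w z0 z d = T_val \<alpha> \<gamma> b m s w z0 z' d"
  by (intro ext) (simp add: T_val_def q_fold_def q_omit_cong[of d z z'])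

lemma Zset_eq_units_mod:
  assumes "prime b" "v < m"
  shows "Zset b m v = units_mod b (m - v)"
proof -
  have "b ^ (m - v) > 0" using assms prime_gt_0_nat by simp
  moreover have "coprime z (b ^ m) \<longleftrightarrow> coprime z b" for z
    using assms by simp
  then have "gcd z (b ^ m) = 1 \<longleftrightarrow> coprime z b" for z
    by (simp only: coprime_iff_gcd_eq_1)
  moreover have "z \<noteq> 0" if "coprime z b" for z
    using that assms(1) by (intro notI) auto
  moreover have "z \<le> b ^ (m - v) - 1 \<longleftrightarrow> z < b ^ (m - v)" for z
    using \<open>b ^ (m - v) > 0\<close> by linarith
  ultimately show ?thesis using assms
    unfolding Zset_def units_mod_def by (auto simp: Suc_le_eq)
qed

lemma units_mod_nonempty: "prime b \<Longrightarrow> l \<ge> 1 \<Longrightarrow> units_mod b l \<noteq> {}"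
  using unit_pow_in_units_mod by blast

lemma T_val_eq_omega_row:
  assumes "\<And>k. k < b ^ (m - w d) \<Longrightarrow> q ! k = q_fold \<alpha> \<gamma> b m s w z0 z d k"
  shows "T_val \<alpha> \<gamma> b m s w z0 z d = omega_row \<alpha> b (m - w d) q"
  using assms unfolding T_val_def omega_row_def
  by (intro ext sum.cong refl) (simp add: omega_res_nat flip: of_nat_mult of_nat_power)

lemma result_divide_out_tm [simp]:
  "result (divide_out_tm \<gamma> N tab d \<xi> q) = map (\<lambda>k. q ! k / (1 + \<gamma> d * tab ! (k * \<xi> mod N))) [0..<N]"
  by (simp add: divide_out_tm_def)

lemma cost_divide_out_tm [simp]: "cost (divide_out_tm \<gamma> N tab d \<xi> q) = 9 * N"
  unfolding divide_out_tm_def by (subst cost_map_tm_const[where c = 8]) auto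

lemma result_multiply_in_tm [simp]:
  "result (multiply_in_tm \<gamma> N tab d \<xi> q) = map (\<lambda>k. q ! k * (1 + \<gamma> d * tab ! (k * \<xi> mod N))) [0..<N]"
  by (simp add: multiply_in_tm_def)

lemma cost_multiply_in_tm [simp]: "cost (multiply_in_tm \<gamma> N tab d \<xi> q) = 9 * N"
  unfolding multiply_in_tm_def by (subst cost_map_tm_const[where c = 8]) auto

lemma result_fold_pieces_tm [simp]:
  "result (fold_pieces_tm Y M q) = map (\<lambda>k. \<Sum>l<Y. q ! (k + l * M)) [0..<M]"
  by (simp add: fold_pieces_tm_def result_fold_tm fold_plus_eq_sum_list interv_sum_list_conv_sum_set_nat
      atLeast0LessThan)

lemma cost_fold_pieces_tm [simp]: "cost (fold_pieces_tm Y M q) = M * (5 * Y + 1)"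
  unfolding fold_pieces_tm_def
  by (subst cost_map_tm_const[where c = "5 * Y"]) (simp_all add: cost_fold_tm_const[where c = 4])

text \<open>Nonvanishing of the initial factor is what makes the division recover
  \<open>q_omit\<close>; multiplying by the new factor then restores the invariant for
  \<open>Suc d\<close>.\<close>

lemma result_scs_step_tm:
  assumes b: "prime b" and d: "w d < m" "1 \<le> d" "d \<le> s"
    and bp: "\<And>i. i \<le> m \<Longrightarrow> bp ! i = b ^ i"
    and tab: "\<And>k. k < b ^ m \<Longrightarrow> tab ! k = omega \<alpha> (real k / real (b ^ m))"
    and q: "\<And>k. k < b ^ m \<Longrightarrow> q ! k = partial_q \<alpha> \<gamma> b m s w z0 z d k"
    and nz: "\<And>k. k < b ^ m \<Longrightarrow> wce_factor \<alpha> \<gamma> (b ^ m) d (z0 d) k \<noteq> 0"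
  shows "\<exists>q' x. result (scs_step_tm \<gamma> b m bp (b ^ m) tab w z0 d (q, z)) = (q', z(d := x)) \<and>
    is_arg_min (T_val \<alpha> \<gamma> b m s w z0 z d) (\<lambda>x. x \<in> Zset b m (w d)) x \<and>
    (\<forall>k<b ^ m. q' ! k = partial_q \<alpha> \<gamma> b m s w z0 (z(d := x)) (Suc d) k)"
proof -
  have b0: "b > 0" using b prime_gt_0_nat by blast
  define n where "n = m - w d"
  have n: "1 \<le> n" "n \<le> m" using d by (auto simp: n_def)
  have [simp]: "bp ! w d = b ^ w d" "bp ! n = b ^ n" using bp d by (auto simp: n_def)
  define qd where "qd = map (\<lambda>k. q ! k / (1 + \<gamma> d * tab ! (k * z0 d mod b ^ m))) [0..<b ^ m]"
  define q1 where "q1 = map (\<lambda>k. \<Sum>l<b ^ w d. qd ! (k + l * b ^ n)) [0..<b ^ n]"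
  define x where "x = result (argmin_tm (result (omega_mult_tm b bp m n tab q1)))"
  define q' where "q' = map (\<lambda>k. qd ! k * (1 + \<gamma> d * tab ! (k * (b ^ w d * x) mod b ^ m))) [0..<b ^ m]"
  have wce: "wce_factor \<alpha> \<gamma> (b ^ m) j \<xi> k = 1 + \<gamma> j * tab ! (k * \<xi> mod b ^ m)" for j \<xi> k
    using wce_factor_eq_table[of "b ^ m" tab \<alpha> \<gamma> j \<xi> k] tab b0 by simp
  have res: "result (scs_step_tm \<gamma> b m bp (b ^ m) tab w z0 d (q, z)) = (q', z(d := x))"
    unfolding scs_step_tm_def q'_def x_def q1_def qd_def by (simp flip: n_def)
  have qd: "qd ! k = q_omit \<alpha> \<gamma> b m s w z0 z d k" if "k < b ^ m" for k
    using that nz[OF that] d(3) by (simp add: qd_def q partial_q_eq_q_omit flip: wce)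
  have "q1 ! k = q_fold \<alpha> \<gamma> b m s w z0 z d k" if k: "k < b ^ n" for k
  proof -
    \<comment> \<open>All pieces lie inside the vector: \<open>w d < m\<close> guarantees
      \<open>b ^ w d * b ^ n = b ^ m\<close>.\<close>
    have "k + l * b ^ n < b ^ m" if "l < b ^ w d" for l
    proof -
      have "k + l * b ^ n < Suc l * b ^ n" using k by simp
      also have "\<dots> \<le> b ^ w d * b ^ n" using that by (intro mult_le_mono1) simp
      also have "\<dots> = b ^ m" using d(1) by (simp add: n_def flip: power_add)
      finally show ?thesis .
    qed
    then show ?thesis using k by (simp add: q1_def q_fold_def qd flip: n_def)
  qed
  then have T: "T_val \<alpha> \<gamma> b m s w z0 z d = omega_row \<alpha> b n q1"
    unfolding n_def by (intro T_val_eq_omega_row) (simp add: n_def)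
  have "is_arg_min (T_val \<alpha> \<gamma> b m s w z0 z d) (\<lambda>x. x \<in> Zset b m (w d)) x"
    unfolding T x_def Zset_eq_units_mod[OF b d(1)] n_def[symmetric]
    by (intro result_argmin_tm set_result_omega_mult_tm[OF b n bp] tab units_mod_nonempty b n)
  moreover have "q' ! k = partial_q \<alpha> \<gamma> b m s w z0 (z(d := x)) (Suc d) k" if "k < b ^ m" for k
    using that d(2) by (simp add: q'_def qd partial_q_Suc wce)
  ultimately show ?thesis using res by blast
qed

lemma length_fst_result_scs_step_tm: "length (fst (result (scs_step_tm \<gamma> b m bp N tab w z0 d qz))) = N"
  by (cases qz) (simp add: scs_step_tm_def)

text \<open>Apart from the matrix-vector product the step is linear: 36 = 8 + 23 + 1 + 4, after
  bounding 1, \<open>b ^ n\<close> and \<open>half_order b n\<close> by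
  \<open>b ^ m\<close>.\<close>

lemma cost_scs_step_tm_le:
  assumes b: "prime b" and d: "w d < m"
    and bp: "\<And>i. i \<le> m \<Longrightarrow> bp ! i = b ^ i"
  shows "cost (scs_step_tm \<gamma> b m bp (b ^ m) tab w z0 d qz) \<le>
    36 * b ^ m + (300 + 50 * b) * ((m - w d) * b ^ (m - w d))"
proof -
  have b0: "b > 0" using b prime_gt_0_nat by blast
  define n where "n = m - w d"
  have n: "1 \<le> n" "n \<le> m" using d by (auto simp: n_def)
  have [simp]: "bp ! w d = b ^ w d" "bp ! n = b ^ n" using bp d by (auto simp: n_def)
  obtain q z where qz: "qz = (q, z)" by fastforce
  define q1 where "q1 = result (fold_pieces_tm (b ^ w d) (b ^ n) (result (divide_out_tm \<gamma> (b ^ m) tab d (z0 d) q)))"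
  have "cost (scs_step_tm \<gamma> b m bp (b ^ m) tab w z0 d qz) =
      8 + 18 * b ^ m + b ^ n * (5 * b ^ w d + 1) + cost (omega_mult_tm b bp m n tab q1)
       + 2 * length (result (omega_mult_tm b bp m n tab q1))"
    unfolding scs_step_tm_def qz q1_def by (simp flip: n_def)
  also have "length (result (omega_mult_tm b bp m n tab q1)) = 2 * half_order b n"
    by (rule length_result_omega_mult_tm[OF b n bp])
  also have "b ^ n * (5 * b ^ w d + 1) = 5 * b ^ m + b ^ n"
    using d by (simp add: n_def distrib_left flip: power_add)
  finally have "cost (scs_step_tm \<gamma> b m bp (b ^ m) tab w z0 d qz) =
      8 + 23 * b ^ m + b ^ n + cost (omega_mult_tm b bp m n tab q1) + 4 * half_order b n"
    by simp
  moreover have "cost (omega_mult_tm b bp m n tab q1) \<le> (300 + 50 * b) * (n * b ^ n)"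
    by (rule cost_omega_mult_tm_le[OF b n bp])
  moreover have "half_order b n \<le> b ^ n" by (rule half_order_le[OF b n(1)])
  moreover have "b ^ n \<le> b ^ m" using n b0 by (simp add: power_increasing)
  moreover have "b ^ m \<ge> 1" using b0 by simp
  ultimately show ?thesis unfolding n_def[symmetric] by linarith
qed

section \<open>Number of searched coordinates\<close>

lemma result_active_tm:
  assumes "d \<ge> 1"
  shows "d - 1 \<le> result (active_tm w m f d) \<and> result (active_tm w m f d) \<le> d - 1 + f \<and>
    (\<forall>j. d \<le> j \<and> j \<le> result (active_tm w m f d) \<longrightarrow> w j < m) \<and>
    (result (active_tm w m f d) < d - 1 + f \<longrightarrow> m \<le> w (Suc (result (active_tm w m f d)))) \<and>
    cost (active_tm w m f d) \<le> 3 * (result (active_tm w m f d) - (d - 1)) + 3"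
  using assms
\<comment> \<open>The start index moves along the recursion while the result is absolute; the value
  \<open>d - 1\<close> says that nothing from \<open>d\<close> on was accepted.\<close>
proof (induction f arbitrary: d)
  case (Suc f)
  show ?case
  proof (cases "w d < m")
    case True
    define r where "r = result (active_tm w m f (Suc d))"
    have IH: "d \<le> r" "r \<le> d + f" "\<forall>j. Suc d \<le> j \<and> j \<le> r \<longrightarrow> w j < m"
      "r < d + f \<longrightarrow> m \<le> w (Suc r)" "cost (active_tm w m f (Suc d)) \<le> 3 * (r - d) + 3"
      using Suc.IH[of "Suc d"] by (auto simp: r_def)
    have "result (active_tm w m (Suc f) d) = r"
      "cost (active_tm w m (Suc f) d) = 3 + cost (active_tm w m f (Suc d))"
      using True by (simp_all add: r_def)
    moreover have "w j < m" if "d \<le> j" "j \<le> r" for j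
      using that IH(3) True by (cases "j = d") auto
    ultimately show ?thesis using IH Suc.prems by auto
  next
    case False
    then show ?thesis using Suc.prems by auto
  qed
qed auto

text \<open>The scan stops at the first index with \<open>w d >= m\<close>; monotonicity makes all
  later indices fail too, so this bounds the supremum in \<open>s_star\<close>. If the scan reaches
  \<open>s\<close>, it says nothing about larger indices, and the minimum with \<open>s\<close>
  decides.\<close>

lemma active_tm_scs_dim:
  assumes mono: "mono_on {1..} w" and "s \<ge> 1"
  shows "result (active_tm w m s 1) = scs_dim s w m" "cost (active_tm w m s 1) \<le> 3 * scs_dim s w m + 3"
    "scs_dim s w m \<le> s" "\<And>j. 1 \<le> j \<Longrightarrow> j \<le> scs_dim s w m \<Longrightarrow> w j < m"
    "\<And>j. scs_dim s w m < j \<Longrightarrow> j \<le> s \<Longrightarrow> m \<le> w j"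
proof -
  define r where "r = result (active_tm w m s 1)"
  have r: "r \<le> s" "\<And>j. 1 \<le> j \<Longrightarrow> j \<le> r \<Longrightarrow> w j < m" "r < s \<Longrightarrow> m \<le> w (Suc r)"
    "cost (active_tm w m s 1) \<le> 3 * r + 3"
    using result_active_tm[of 1 w m s] by (auto simp: r_def)
  have ge: "m \<le> w j" if "r < s" "r < j" for j
  proof -
    have "w (Suc r) \<le> w j" using that by (intro mono_onD[OF mono]) auto
    then show ?thesis using r(3) that by simp
  qed
  have "min (enat s) (s_star w m) = enat r"
  proof (cases "r = s")
    case True
    then have "enat s \<in> {enat j | j. j \<ge> 1 \<and> w j < m}" using r(2)[of s] \<open>s \<ge> 1\<close> by auto
    then have "enat s \<le> s_star w m" unfolding s_star_def by (rule Sup_upper)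
    then show ?thesis using True by simp
  next
    case False
    with r(1) have "r < s" by simp
    have "s_star w m \<le> enat r"
      unfolding s_star_def
    proof (rule Sup_least)
      fix e assume "e \<in> {enat j | j. j \<ge> 1 \<and> w j < m}"
      then obtain j where "e = enat j" "w j < m" by auto
      then show "e \<le> enat r" using ge[OF \<open>r < s\<close>, of j] by (cases "j \<le> r") auto
    qed
    moreover have "enat r \<le> s_star w m"
    proof (cases "r = 0")
      case False
      then have "enat r \<in> {enat j | j. j \<ge> 1 \<and> w j < m}" using r(2)[of r] by auto
      then show ?thesis unfolding s_star_def by (rule Sup_upper)
    qed (simp add: zero_enat_def[symmetric])
    ultimately show ?thesis using \<open>r < s\<close> by (simp add: min_def)
  qed
  then have dim: "scs_dim s w m = r" by (simp add: scs_dim_def)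
  show "result (active_tm w m s 1) = scs_dim s w m" "cost (active_tm w m s 1) \<le> 3 * scs_dim s w m + 3"
    "scs_dim s w m \<le> s" "\<And>j. 1 \<le> j \<Longrightarrow> j \<le> scs_dim s w m \<Longrightarrow> w j < m"
    unfolding dim using r by (simp_all only: r_def)
  show "m \<le> w j" if "scs_dim s w m < j" "j \<le> s" for j
    using ge[of j] that unfolding dim by linarith
qed

section \<open>Correctness and cost of the complete algorithm\<close>

lemma fold_times_eq_prod: "fold (\<lambda>j v. v * f j) [1..<Suc n] t = t * (\<Prod>j=1..n. f j)"
  for f :: "nat \<Rightarrow> 'a::comm_monoid_mult"
  by (induction n) (simp_all add: mult_ac)

lemma result_init_q_tm [simp]:
  "result (init_q_tm \<gamma> N tab n t z0) =
    map (\<lambda>k. t * (\<Prod>j=1..n. 1 + \<gamma> j * tab ! (k * z0 j mod N))) [0..<N]"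
  by (simp add: init_q_tm_def result_fold_tm fold_times_eq_prod[unfolded One_nat_def] del: upt_Suc)

lemma cost_init_q_tm [simp]: "cost (init_q_tm \<gamma> N tab n t z0) = N * (9 * n + 1)"
  unfolding init_q_tm_def
  by (subst cost_map_tm_const[where c = "9 * n"]) (simp_all add: cost_fold_tm_const[where c = 8] del: upt_Suc)

lemma fold_upt_invariant:
  assumes "P 1 a" "\<And>d a. 1 \<le> d \<Longrightarrow> d \<le> n \<Longrightarrow> P d a \<Longrightarrow> P (Suc d) (f d a)"
  shows "P (Suc n) (fold f [1..<Suc n] a)"
  using assms
proof (induction n)
  case (Suc n)
  then have "P (Suc n) (fold f [1..<Suc n] a)" by simp
  then show ?case using Suc.prems(2)[of "Suc n" "fold f [1..<Suc n] a"] by simp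
qed simp

text \<open>Beyond the searched coordinates \<open>z0 j\<close> and \<open>b ^ w j\<close> both
  vanish modulo \<open>b ^ m\<close>. The initial tail of the product is therefore the final one,
  and a constant independent of \<open>k\<close> represents it.\<close>

lemma scs_outcome_reduced_fast_scs:
  assumes b: "prime b" and s: "s \<ge> 1" and mono: "mono_on {1..} w"
    and init: "admissible_init b m s w z0"
    and nz: "\<And>j k. j \<in> {1..scs_dim s w m} \<Longrightarrow> k < b ^ m \<Longrightarrow> wce_factor \<alpha> \<gamma> (b ^ m) j (z0 j) k \<noteq> 0"
  shows "scs_outcome \<alpha> \<gamma> b m s w z0 (result (reduced_fast_scs \<alpha> cw \<gamma> b m s w z0))"
proof -
  have b0: "b > 0" using b prime_gt_0_nat by blast
  define n where "n = scs_dim s w m"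
  have act: "result (active_tm w m s 1) = n" and ns: "n \<le> s"
    and wlt: "\<And>j. 1 \<le> j \<Longrightarrow> j \<le> n \<Longrightarrow> w j < m" and wge: "\<And>j. n < j \<Longrightarrow> j \<le> s \<Longrightarrow> m \<le> w j"
    using active_tm_scs_dim[OF mono s, where m = m] by (simp_all add: n_def)
  define N where "N = b ^ m"
  have "N > 0" using b0 by (simp add: N_def)
  define bp where "bp = map ((^) b) [0..<m + 1]"
  define tab where "tab = map (\<lambda>k. omega \<alpha> (real k / real N)) [0..<N]"
  have bp: "bp ! i = b ^ i" if "i \<le> m" for i using that by (simp add: bp_def del: upt_Suc)
  have tab: "tab ! k = omega \<alpha> (real k / real (b ^ m))" if "k < b ^ m" for k
    using that by (simp add: tab_def N_def)
  define q where "q = map (\<lambda>k. tail_const \<gamma> n s (tab ! 0) * (\<Prod>j=1..n. 1 + \<gamma> j * tab ! (k * z0 j mod N))) [0..<N]"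
  have wce: "wce_factor \<alpha> \<gamma> (b ^ m) j \<xi> k = 1 + \<gamma> j * tab ! (k * \<xi> mod b ^ m)" for j \<xi> k
    using wce_factor_eq_table[of "b ^ m" tab \<alpha> \<gamma> j \<xi> k] tab b0 by simp
  \<comment> \<open>For \<open>w j >= m\<close> the set \<open>Zset b m (w j)\<close> is
    \<open>{1}\<close>, which fixes the residue of \<open>z0 j\<close>.\<close>
  have z0: "[z0 j = b ^ w j] (mod b ^ m)" if "n < j" "j \<le> s" for j
  proof -
    have "j \<in> {1..s}" using that by simp
    then obtain zb where "zb \<in> Zset b m (w j)" "[z0 j = b ^ w j * zb] (mod b ^ m)"
      using init unfolding admissible_init_def by blast
    then show ?thesis using wge[OF that] by (simp add: Zset_def)
  qed
  have tail: "(\<Prod>j\<in>{n<..s}. wce_factor \<alpha> \<gamma> (b ^ m) j (b ^ w j) k) = tail_const \<gamma> n s (tab ! 0)" for k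
    unfolding tail_const_def
  proof (intro prod.cong refl)
    fix j assume "j \<in> {n<..s}"
    then have "b ^ m dvd b ^ w j" using wge[of j] by (intro le_imp_power_dvd) auto
    then have "k * b ^ w j mod b ^ m = 0" by simp
    then show "wce_factor \<alpha> \<gamma> (b ^ m) j (b ^ w j) k = 1 + \<gamma> j * tab ! 0" by (simp add: wce)
  qed
  have split: "(\<Prod>j=1..s. f j) = (\<Prod>j=1..n. f j) * (\<Prod>j\<in>{n<..s}. f j)" for f :: "nat \<Rightarrow> real"
  proof -
    have "{1..s} = {1..n} \<union> {n<..s}" using ns by auto
    then show ?thesis by (simp only:) (rule prod.union_disjoint, auto)
  qed
  have q: "q ! k = partial_q \<alpha> \<gamma> b m s w z0 z 1 k" if "k < b ^ m" for k z
  proof -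
    have "partial_q \<alpha> \<gamma> b m s w z0 z 1 k =
        (\<Prod>j=1..n. wce_factor \<alpha> \<gamma> (b ^ m) j (z0 j) k) * (\<Prod>j\<in>{n<..s}. wce_factor \<alpha> \<gamma> (b ^ m) j (z0 j) k)"
      unfolding partial_q_def split by simp
    also have "(\<Prod>j\<in>{n<..s}. wce_factor \<alpha> \<gamma> (b ^ m) j (z0 j) k) = (\<Prod>j\<in>{n<..s}. wce_factor \<alpha> \<gamma> (b ^ m) j (b ^ w j) k)"
      using z0 b0 by (intro prod.cong refl wce_factor_cong) auto
    finally show ?thesis using that unfolding tail by (simp add: q_def wce N_def)
  qed
  \<comment> \<open>\<open>I d\<close> describes the state on entry to iteration \<open>d\<close>.
    The length is kept for the final summation, and the last conjunct supplies
    \<open>z j = 1\<close> for the components that are never written.\<close>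
  define I where "I = (\<lambda>d (q, z). length q = N \<and>
      (\<forall>k<b ^ m. q ! k = partial_q \<alpha> \<gamma> b m s w z0 z d k) \<and>
      (\<forall>j\<in>{1..<d}. is_arg_min (T_val \<alpha> \<gamma> b m s w z0 z j) (\<lambda>x. x \<in> Zset b m (w j)) (z j)) \<and>
      (\<forall>j\<ge>d. z j = 1))"
  define step where "step = (\<lambda>d a. result (scs_step_tm \<gamma> b m bp N tab w z0 d a))"
  obtain q' z where q'z: "fold step [1..<Suc n] (q, \<lambda>_. 1) = (q', z)" by fastforce
  have "I (Suc n) (fold step [1..<Suc n] (q, \<lambda>_. 1))"
  proof (rule fold_upt_invariant)
    show "I 1 (q, \<lambda>_. 1)" using q by (simp add: I_def q_def)
  next
    fix d a assume d: "1 \<le> d" "d \<le> n" and "I d a"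
    then obtain q z where a: "a = (q, z)" and
      qz: "\<forall>k<b ^ m. q ! k = partial_q \<alpha> \<gamma> b m s w z0 z d k"
        "\<forall>j\<in>{1..<d}. is_arg_min (T_val \<alpha> \<gamma> b m s w z0 z j) (\<lambda>x. x \<in> Zset b m (w j)) (z j)"
        "\<forall>j\<ge>d. z j = 1"
      by (cases a) (auto simp: I_def)
    have "\<exists>q' x. result (scs_step_tm \<gamma> b m bp (b ^ m) tab w z0 d (q, z)) = (q', z(d := x)) \<and>
      is_arg_min (T_val \<alpha> \<gamma> b m s w z0 z d) (\<lambda>x. x \<in> Zset b m (w d)) x \<and>
      (\<forall>k<b ^ m. q' ! k = partial_q \<alpha> \<gamma> b m s w z0 (z(d := x)) (Suc d) k)"
      using d ns wlt[of d] qz(1) nz[of d] bp tab by (intro result_scs_step_tm b) (auto simp: n_def)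
    then obtain q' x where res: "step d a = (q', z(d := x))"
      and x: "is_arg_min (T_val \<alpha> \<gamma> b m s w z0 z d) (\<lambda>x. x \<in> Zset b m (w d)) x"
      and q': "\<forall>k<b ^ m. q' ! k = partial_q \<alpha> \<gamma> b m s w z0 (z(d := x)) (Suc d) k"
      unfolding step_def a N_def by blast
    have "length q' = N"
      using length_fst_result_scs_step_tm[of \<gamma> b m bp N tab w z0 d a] res by (simp add: step_def)
    moreover have "is_arg_min (T_val \<alpha> \<gamma> b m s w z0 (z(d := x)) j) (\<lambda>x. x \<in> Zset b m (w j)) ((z(d := x)) j)"
      if "j \<in> {1..<Suc d}" for j
    proof -
      have "T_val \<alpha> \<gamma> b m s w z0 (z(d := x)) j = T_val \<alpha> \<gamma> b m s w z0 z j"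
        using that by (intro T_val_cong) auto
      then show ?thesis using that qz(2) x by (cases "j = d") auto
    qed
    ultimately show "I (Suc d) (step d a)" using q' qz(3) by (simp add: res I_def)
  qed
  then have inv: "length q' = N" "\<forall>k<b ^ m. q' ! k = partial_q \<alpha> \<gamma> b m s w z0 z (Suc n) k"
      "\<forall>j\<in>{1..n}. is_arg_min (T_val \<alpha> \<gamma> b m s w z0 z j) (\<lambda>x. x \<in> Zset b m (w j)) (z j)"
      "\<forall>j>n. z j = 1"
    unfolding q'z by (auto simp: I_def Suc_le_eq)
  have res: "result (reduced_fast_scs \<alpha> cw \<gamma> b m s w z0) = (z, - 1 + (\<Sum>k<N. q' ! k) / real N)"
  proof -
    have "fold (\<lambda>x a. a + x) q' 0 = (\<Sum>k<N. q' ! k)"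
      using fold_plus_eq_sum_list[of "\<lambda>x. x" q' 0] inv(1) by (simp add: sum_list_sum_nth atLeast0LessThan)
    then show ?thesis
      unfolding reduced_fast_scs_def using act bp[of m] q'z
      by (simp add: result_fold_tm del: upt_Suc One_nat_def flip: N_def bp_def tab_def q_def step_def)
  qed
  have "q' ! k = (\<Prod>j=1..s. wce_factor \<alpha> \<gamma> (b ^ m) j (b ^ w j * z j) k)" if "k < N" for k
  proof -
    have "(\<Prod>j=1..s. wce_factor \<alpha> \<gamma> (b ^ m) j (b ^ w j * z j) k) =
        (\<Prod>j=1..<Suc n. wce_factor \<alpha> \<gamma> (b ^ m) j (b ^ w j * z j) k) *
        (\<Prod>j\<in>{n<..s}. wce_factor \<alpha> \<gamma> (b ^ m) j (b ^ w j * z j) k)"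
      unfolding split atLeastLessThanSuc_atLeastAtMost ..
    \<comment> \<open>The tail still made of initial factors is recognised as the final one, by
      \<open>z j = 1\<close> for \<open>j > n\<close>.\<close>
    also have "(\<Prod>j\<in>{n<..s}. wce_factor \<alpha> \<gamma> (b ^ m) j (b ^ w j * z j) k) =
        (\<Prod>j\<in>{n<..s}. wce_factor \<alpha> \<gamma> (b ^ m) j (z0 j) k)"
      using inv(4) z0 b0 by (intro prod.cong refl wce_factor_cong) (auto simp: cong_sym)
    also have "{n<..s} = {Suc n..s}" by auto
    finally show ?thesis using inv(2) that by (simp add: partial_q_def N_def)
  qed
  then have "- 1 + (\<Sum>k<N. q' ! k) / real N = sq_wce \<alpha> \<gamma> (b ^ m) s (\<lambda>j. b ^ w j * z j)"
    by (simp add: sq_wce_def N_def)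
  then show ?thesis
    using inv by (simp add: scs_outcome_def res n_def)
qed

lemma cost_reduced_fast_scs_le:
  assumes b: "prime b" and s: "s \<ge> 1" and m: "m \<ge> 1" and mono: "mono_on {1..} w"
  defines "n \<equiv> scs_dim s w m"
  shows "cost (reduced_fast_scs \<alpha> cw \<gamma> b m s w z0) \<le>
    cw (b ^ m) + 15 * (m * b ^ m) + 50 * (n * b ^ m) +
    (300 + 50 * b) * (\<Sum>d=1..n. (m - w d) * b ^ (m - w d))"
proof -
  have b0: "b > 0" using b prime_gt_0_nat by blast
  have act: "result (active_tm w m s 1) = n" "cost (active_tm w m s 1) \<le> 3 * n + 3"
    and wlt: "\<And>j. 1 \<le> j \<Longrightarrow> j \<le> n \<Longrightarrow> w j < m"
    using active_tm_scs_dim[OF mono s, where m = m] by (simp_all add: n_def)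
  define N where "N = b ^ m"
  have "N \<ge> 1" using b0 by (simp add: N_def)
  define bp where "bp = map ((^) b) [0..<m + 1]"
  define tab where "tab = map (\<lambda>k. omega \<alpha> (real k / real N)) [0..<N]"
  have bp: "bp ! i = b ^ i" if "i \<le> m" for i using that by (simp add: bp_def del: upt_Suc)
  define q where "q = map (\<lambda>k. tail_const \<gamma> n s (tab ! 0) * (\<Prod>j=1..n. 1 + \<gamma> j * tab ! (k * z0 j mod N))) [0..<N]"
  define loop where "loop = fold_tm (scs_step_tm \<gamma> b m bp N tab w z0) [1..<Suc n] (q, \<lambda>_. 1)"
  have len: "length (fst (result loop)) = N"
    unfolding loop_def result_fold_tm
    by (rule fold_upt_invariant[where P = "\<lambda>d a. length (fst a) = N"])
       (simp_all add: q_def length_fst_result_scs_step_tm)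
  have "cost loop \<le> (\<Sum>d\<leftarrow>[1..<Suc n]. 36 * N + (300 + 50 * b) * ((m - w d) * b ^ (m - w d)) + 1)"
    unfolding loop_def
  proof (rule cost_fold_tm_le[where P = "\<lambda>_. True"])
    fix d a assume "d \<in> set [1..<Suc n]"
    then have "w d < m" using wlt by auto
    then show "cost (scs_step_tm \<gamma> b m bp N tab w z0 d a) \<le> 36 * N + (300 + 50 * b) * ((m - w d) * b ^ (m - w d))"
      unfolding N_def by (intro cost_scs_step_tm_le b bp)
  qed auto
  also have "\<dots> = 36 * (n * N) + n + (300 + 50 * b) * (\<Sum>d=1..n. (m - w d) * b ^ (m - w d))"
    by (simp add: interv_sum_list_conv_sum_set_nat atLeastLessThanSuc_atLeastAtMost sum.distrib sum_distrib_left
        del: upt_Suc Suc_eq_plus1 add_Suc_right)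
  finally have loop: "cost loop \<le> \<dots>" .
  have "cost (reduced_fast_scs \<alpha> cw \<gamma> b m s w z0) =
      2 * m + 6 + cw N + cost (active_tm w m s 1) + N * (9 * n + 1) + cost loop + 2 * N"
    unfolding reduced_fast_scs_def using act(1) bp[of m] len
    by (simp add: case_prod_beta cost_fold_tm_const[where c = 1] del: upt_Suc One_nat_def
        flip: N_def bp_def tab_def q_def loop_def)
  also have "\<dots> \<le> cw N + 15 * (m * N) + 50 * (n * N) + (300 + 50 * b) * (\<Sum>d=1..n. (m - w d) * b ^ (m - w d))"
  proof -
    define A B S where "A = m * N" and "B = n * N"
      and "S = (300 + 50 * b) * (\<Sum>d=1..n. (m - w d) * b ^ (m - w d))"
    \<comment> \<open>As \<open>n\<close> may be 0, single operations and multiples of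
      \<open>N\<close> are charged to \<open>m * N\<close>, which needs \<open>m >= 1\<close>. The
      coefficients come to 14 and 49.\<close>
    have "m \<le> A" "n \<le> B" "N \<le> A" using \<open>N \<ge> 1\<close> m by (simp_all add: A_def B_def)
    moreover have eq: "N * (9 * n + 1) = 9 * B + N" by (simp add: B_def algebra_simps)
    ultimately show ?thesis
      using loop act(2) \<open>N \<ge> 1\<close> unfolding eq A_def[symmetric] B_def[symmetric] S_def[symmetric] by linarith
  qed
  finally show ?thesis by (simp add: N_def)
qed

section \<open>The asymptotic bound\<close>

lemma bigo_n_ln_n_power_bound:
  fixes b :: nat and f :: "nat \<Rightarrow> real"
  assumes "b \<ge> 2" "f \<in> O(\<lambda>N. real N * ln (real N))"
  shows "\<exists>K\<ge>0. \<forall>m\<ge>1. f (b ^ m) \<le> K * (real m * real b ^ m)"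
proof -
  obtain c where c: "c > 0" "eventually (\<lambda>N. norm (f N) \<le> c * norm (real N * ln (real N))) at_top"
    using assms(2) by (auto elim: landau_o.bigE)
  then obtain N0 where N0: "\<And>N. N \<ge> N0 \<Longrightarrow> norm (f N) \<le> c * norm (real N * ln (real N))"
    by (auto simp: eventually_at_top_linorder)
  \<comment> \<open>\<open>A\<close> dominates the finitely many values below the threshold, where
    the asymptotic hypothesis is silent; it can be scaled because \<open>m * b ^ m >= 1\<close> for
    \<open>m >= 1\<close>.\<close>
  define A where "A = (\<Sum>N<N0. \<bar>f N\<bar>)"
  have "A \<ge> 0" by (simp add: A_def)
  have lnb: "ln (real b) \<ge> 0" using assms by simp
  have "f (b ^ m) \<le> (A + c * ln (real b)) * (real m * real b ^ m)" if "m \<ge> 1" for m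
  proof (cases "b ^ m < N0")
    case True
    then have "\<bar>f (b ^ m)\<bar> \<le> A"
      unfolding A_def by (intro member_le_sum) auto
    moreover have "1 * 1 \<le> real m * real b ^ m"
      using that assms by (intro mult_mono one_le_power) auto
    then have "A * 1 \<le> A * (real m * real b ^ m)"
      using \<open>A \<ge> 0\<close> by (intro mult_left_mono) auto
    moreover have "0 \<le> c * ln (real b) * (real m * real b ^ m)"
      using c lnb by simp
    ultimately show ?thesis by (simp add: distrib_right)
  next
    case False
    then have "f (b ^ m) \<le> c * \<bar>real (b ^ m) * ln (real (b ^ m))\<bar>"
      using N0[of "b ^ m"] by simp
    also have "\<dots> = c * ln (real b) * (real m * real b ^ m)"
      using assms lnb by (simp add: ln_realpow abs_mult)
    also have "\<dots> \<le> (A + c * ln (real b)) * (real m * real b ^ m)"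
      using \<open>A \<ge> 0\<close> by (intro mult_right_mono) auto
    finally show ?thesis .
  qed
  moreover have "A + c * ln (real b) \<ge> 0" using \<open>A \<ge> 0\<close> c lnb by simp
  ultimately show ?thesis by blast
qed

theorem theorem7:
  fixes b :: nat and \<alpha> :: real and cw :: "nat \<Rightarrow> nat"
  assumes "prime b"
    and "\<alpha> > 1"
    and "(\<lambda>N. real (cw N)) \<in> O(\<lambda>N. real N * ln (real N))"
  shows "\<exists>C::real. C > 0 \<and>
    (\<forall>(m::nat) (s::nat) (\<gamma> :: nat \<Rightarrow> real) (w :: nat \<Rightarrow> nat) (z0 :: nat \<Rightarrow> nat).
       m \<ge> 1 \<longrightarrow> s \<ge> 1 \<longrightarrow> (\<forall>j\<ge>1. \<gamma> j > 0) \<longrightarrow> mono_on {1..} w \<longrightarrow>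
       admissible_init b m s w z0 \<longrightarrow>
       real (cost (reduced_fast_scs \<alpha> cw \<gamma> b m s w z0)) \<le>
         C * (real m * real b ^ m + real (scs_dim s w m) * real b ^ m
              + (\<Sum>d=1..scs_dim s w m. real (m - w d) * real b ^ (m - w d))) \<and>
       ((\<forall>j\<in>{1..scs_dim s w m}. \<forall>k<b ^ m. wce_factor \<alpha> \<gamma> (b ^ m) j (z0 j) k \<noteq> 0) \<longrightarrow>
          scs_outcome \<alpha> \<gamma> b m s w z0 (result (reduced_fast_scs \<alpha> cw \<gamma> b m s w z0))))"
proof -
  obtain K where K: "K \<ge> 0" "\<And>m. m \<ge> 1 \<Longrightarrow> real (cw (b ^ m)) \<le> K * (real m * real b ^ m)"
    using bigo_n_ln_n_power_bound[OF prime_ge_2_nat[OF assms(1)] assms(3)] by auto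
  \<comment> \<open>\<open>L\<close> is the coefficient of the sum over the coordinates and also
    exceeds 15 and 50, so \<open>K + L\<close> covers all three terms. It depends on
    \<open>b\<close> and \<open>cw\<close> only.\<close>
  define L where "L = real (300 + 50 * b)"
  show ?thesis
  proof (intro exI[of _ "K + L"] conjI allI impI)
    show "K + L > 0" using K(1) by (simp add: L_def)
  next
    fix m s :: nat and \<gamma> :: "nat \<Rightarrow> real" and w z0 :: "nat \<Rightarrow> nat"
    assume m: "m \<ge> 1" and s: "s \<ge> 1" and mono: "mono_on {1..} w"
    define n where "n = scs_dim s w m"
    define X where "X = real m * real b ^ m"
    define Y where "Y = real n * real b ^ m"
    define Z where "Z = (\<Sum>d=1..n. real (m - w d) * real b ^ (m - w d))"
    have nonneg: "X \<ge> 0" "Y \<ge> 0" "Z \<ge> 0" by (simp_all add: X_def Y_def Z_def sum_nonneg)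
    have "real (cost (reduced_fast_scs \<alpha> cw \<gamma> b m s w z0)) \<le>
        real (cw (b ^ m) + 15 * (m * b ^ m) + 50 * (n * b ^ m) +
          (300 + 50 * b) * (\<Sum>d=1..n. (m - w d) * b ^ (m - w d)))"
      unfolding n_def by (intro of_nat_mono cost_reduced_fast_scs_le assms s m mono)
    also have "\<dots> = real (cw (b ^ m)) + 15 * X + 50 * Y + L * Z"
      by (simp add: X_def Y_def Z_def L_def)
    also have "\<dots> \<le> (K * X + L * X) + (K * Y + L * Y) + (K * Z + L * Z)"
    proof -
      have "real (cw (b ^ m)) \<le> K * X" unfolding X_def by (rule K(2)[OF m])
      moreover have "15 * X \<le> L * X" "50 * Y \<le> L * Y"
        using nonneg by (auto simp: L_def intro!: mult_right_mono)
      moreover have "K * Y \<ge> 0" "K * Z \<ge> 0" using nonneg K by simp_all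
      ultimately show ?thesis by linarith
    qed
    also have "\<dots> = (K + L) * (X + Y + Z)" by (simp add: algebra_simps)
    finally show "real (cost (reduced_fast_scs \<alpha> cw \<gamma> b m s w z0)) \<le>
         (K + L) * (real m * real b ^ m + real (scs_dim s w m) * real b ^ m
              + (\<Sum>d=1..scs_dim s w m. real (m - w d) * real b ^ (m - w d)))"
      by (simp add: X_def Y_def Z_def n_def)
  next
    fix m s :: nat and \<gamma> :: "nat \<Rightarrow> real" and w z0 :: "nat \<Rightarrow> nat"
    assume "s \<ge> 1" "mono_on {1..} w" "admissible_init b m s w z0"
      "\<forall>j\<in>{1..scs_dim s w m}. \<forall>k<b ^ m. wce_factor \<alpha> \<gamma> (b ^ m) j (z0 j) k \<noteq> 0"
    then show "scs_outcome \<alpha> \<gamma> b m s w z0 (result (reduced_fast_scs \<alpha> cw \<gamma> b m s w z0))"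
      by (intro scs_outcome_reduced_fast_scs assms) auto
  qed
qed

end
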